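(* Assume $\mathrm{cov}(\overline{\mathcal N})=\mathfrak c$. Then each zero-closed compact Hausdorff topological semigroup is polyfinite.
   Context: $\mathfrak c$ is the cardinality of the continuum and $\mathrm{cov}(\overline{\mathcal N})$ is the smallest cardinality of a cover of the real line by closed subsets of Lebesgue measure zero. For a semigroup $X$, the $0$-extension of $X$ is the semigroup $X^0=X\cup\{0\}$, where $0\notin X$ is a new element with $0x=0=x0$ for every $x\in X^0$; the $1$-extension of $X$ is the semigroup $X^1=X\cup\{1\}$, where $1\notin X$ is a new element with $1x=x=x1$ for every $x\in X^1$. A topology on a semigroup $S$ is a semigroup topology if the binary operation $S\times S\to S$ is continuous; a topological semigroup is a semigroup endowed with a semigroup topology. A semigroup $X$ is zero-closed if $X$ is a closed subset of $X^0$ for every Hausdorff semigroup topology on $X^0$ (this is a property of the abstract semigroup $X$; the topologies on $X^0$ need not be related to any given topology on $X$). A semigroup polynomial on $X$ is a function $f:X\to X$ of the form $f(x)=a_0xa_1x\cdots xa_n$ for some integer $n\ge 1$ and some $a_0,\dots,a_n\in X^1$; $n$ is its degree. A semigroup $X$ is polyfinite if there exist $n\in\mathbb N$ and a finite set $F\subseteq X$ such that for any $x,y\in X$ there exists a semigroup polynomial $f:X\to X$ of degree $\le n$ with $\{f(x),f(y)\}\subseteq F$. *)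

theory Defs
  imports "HOL-Analysis.Analysis"
begin

unbundle cardinal_syntax

text \<open>The new element is adjoined even if the semigroup already has a zero or a unit.\<close>

datatype 'a zero_ext = Zero_new | Elem0 'a

instantiation zero_ext :: (semigroup_mult) "{semigroup_mult, mult_zero}"
begin

definition zero_zero_ext :: "'a zero_ext" where
  "0 = Zero_new"

definition times_zero_ext :: "'a zero_ext \<Rightarrow> 'a zero_ext \<Rightarrow> 'a zero_ext" where
  "u * v = (case (u, v) of (Elem0 x, Elem0 y) \<Rightarrow> Elem0 (x * y) | _ \<Rightarrow> Zero_new)"

instance
  by standard (auto simp: zero_zero_ext_def times_zero_ext_def mult.assoc split: zero_ext.splits)

end

datatype 'a one_ext = One_new | Elem1 'a

instantiation one_ext :: (semigroup_mult) monoid_mult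
begin

definition one_one_ext :: "'a one_ext" where
  "1 = One_new"

definition times_one_ext :: "'a one_ext \<Rightarrow> 'a one_ext \<Rightarrow> 'a one_ext" where
  "u * v = (case u of One_new \<Rightarrow> v | Elem1 x \<Rightarrow>
             (case v of One_new \<Rightarrow> Elem1 x | Elem1 y \<Rightarrow> Elem1 (x * y)))"

instance
  by standard (auto simp: one_one_ext_def times_one_ext_def mult.assoc split: one_ext.splits)

end

definition semigroup_topology :: "'a::semigroup_mult topology \<Rightarrow> bool" where
  "semigroup_topology T \<longleftrightarrow>
     topspace T = UNIV \<and> continuous_map (prod_topology T T) T (\<lambda>(x, y). x * y)"

definition zero_closed :: "'a::semigroup_mult itself \<Rightarrow> bool" where
  "zero_closed _ \<longleftrightarrow>
     (\<forall>T :: 'a zero_ext topology. semigroup_topology T \<and> Hausdorff_space T \<longrightarrow>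
        closedin T (range Elem0))"

text \<open>\<open>poly_word a n x\<close> is the product \<open>a\<^sub>0 x a\<^sub>1 x \<dots> x a\<^sub>n\<close>, computed in the 1-extension;
  for \<open>n \<ge> 1\<close> it lies in the semigroup itself.\<close>

primrec poly_word :: "(nat \<Rightarrow> 'a::semigroup_mult one_ext) \<Rightarrow> nat \<Rightarrow> 'a \<Rightarrow> 'a one_ext" where
  "poly_word a 0 x = a 0"
| "poly_word a (Suc n) x = poly_word a n x * Elem1 x * a (Suc n)"

definition semigroup_polynomial :: "nat \<Rightarrow> ('a::semigroup_mult \<Rightarrow> 'a) \<Rightarrow> bool" where
  "semigroup_polynomial n f \<longleftrightarrow> n \<ge> 1 \<and> (\<exists>a. \<forall>x. Elem1 (f x) = poly_word a n x)"

definition polyfinite :: "'a::semigroup_mult itself \<Rightarrow> bool" where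
  "polyfinite _ \<longleftrightarrow>
     (\<exists>(n::nat) (F::'a set). finite F \<and>
        (\<forall>x y. \<exists>m f. m \<le> n \<and> semigroup_polynomial m f \<and> {f x, f y} \<subseteq> F))"

definition closed_null_covers :: "real set set set" where
  "closed_null_covers =
     {U. (\<forall>A\<in>U. closed A \<and> A \<in> null_sets lebesgue) \<and> \<Union>U = UNIV}"

text \<open>Cardinals are canonical only up to \<open>=o\<close>, so one cover of least cardinality is chosen.\<close>

definition cov_closed_null :: "real set rel" where
  "cov_closed_null =
     (SOME r. \<exists>U\<in>closed_null_covers. r = |U| \<and> (\<forall>V\<in>closed_null_covers. |U| \<le>o |V| ))"

lemma cov_closed_null_minimal:
  "\<exists>U\<in>closed_null_covers. cov_closed_null = |U| \<and> (\<forall>V\<in>closed_null_covers. |U| \<le>o |V| )"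
proof -
  have "{x} \<in> null_sets lebesgue" for x :: real
    by (rule null_sets_completionI) (simp add: finite_imp_null_set_lborel)
  then have "range (\<lambda>x::real. {x}) \<in> closed_null_covers"
    unfolding closed_null_covers_def by auto
  then have "card_of ` closed_null_covers \<noteq> {}"
    by blast
  moreover have "\<forall>r\<in>card_of ` closed_null_covers. Card_order r"
    using card_of_Card_order by blast
  ultimately have "\<exists>r\<in>card_of ` closed_null_covers. \<forall>s\<in>card_of ` closed_null_covers. r \<le>o s"
    by (rule exists_minim_Card_order)
  then obtain U where "U \<in> closed_null_covers" and "\<forall>V\<in>closed_null_covers. |U| \<le>o |V|"
    by (auto simp only: bex_simps ball_simps)
  then have "\<exists>r. \<exists>U\<in>closed_null_covers. r = |U| \<and> (\<forall>V\<in>closed_null_covers. |U| \<le>o |V| )"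
    by (intro exI[of _ "|U|"] bexI[of _ U] conjI refl)
  then show ?thesis
    unfolding cov_closed_null_def by (rule someI_ex)
qed

end

theory Submission
  imports Defs
begin

text \<open>Let \<open>X\<close> be a compact Hausdorff semigroup that is not polyfinite. A Hausdorff semigroup topology on
the 0-extension is constructed in which \<open>0\<close> is not isolated, so that \<open>X\<close> is not zero-closed.

Let \<open>e\<close> be an idempotent in a minimal left ideal; then \<open>G = e X e\<close> is a compact group
(\<open>ex_unit_of_maximal_group\<close>). Multiplication by \<open>e\<close> on both sides turns polynomials over \<open>X\<close> into
polynomials over \<open>G\<close>, and in \<open>G\<close> one can divide. So for each \<open>n\<close> there is a pair of
elements of \<open>G\<close> that no polynomial over \<open>G\<close> of degree between \<open>1\<close> and \<open>n\<close> maps to one point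
(\<open>polys_separate_pairs\<close>). Countably many continuous functions witness this for all \<open>n\<close>, and they
define a closed congruence \<open>E\<close> on \<open>X\<close> with at most continuum many classes modulo which the pairs
remain separated (\<open>polys_separate_pairs_modulo\<close>, \<open>syntactic_code\<close>).

Moreover, pairs not identified in degree at most \<open>n\<close> exist inside every nonempty open
subset \<open>W\<close> of \<open>G\<close> (\<open>poly_glued_thin\<close>): by recurrence, powers of \<open>x y\<^sup>-\<^sup>1\<close> return to every neighbourhood of \<open>e\<close> within a bounded number of steps,
so a polynomial of bounded degree moves a pair \<open>(x, y)\<close> into \<open>W\<close>. A perfect set construction
(\<open>cantor_scheme\<close>) then yields continuum many elements \<open>\<zeta> t\<close> of \<open>G\<close> such that a nontrivial
equation \<open>f x = g\<close>, with a polynomial \<open>f\<close> over \<open>X\<close> and an element \<open>g\<close>, is satisfied modulo \<open>E\<close> by only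
finitely many of them (\<open>finite_solutions\<close>).

Consequently one can enumerate \<open>X\<close> modulo \<open>E\<close> in order type continuum and choose, at each stage, some
\<open>\<zeta> t\<close> that satisfies no equation over the subsemigroup generated so far (\<open>ex_generic\<close>,
\<open>not_zero_closed_if_few_solutions\<close>). The elements of \<open>X\<close> that arise from the choices made after a
given stage form a neighbourhood of \<open>0\<close>. These neighbourhoods are nested, are preserved by
multiplication with elements of the respective stage, and are disjoint from that stage
(\<open>not_zero_closed_if_filtration\<close>).\<close>

section \<open>Topologies with a non-isolated adjoined zero\<close>

text \<open>A semigroup topology on the 0-extension in which all old points are isolated and \<open>0\<close> is not.
The sets \<open>V i\<close>, the unions of the \<open>W j\<close> with \<open>j\<close> at or above \<open>i\<close>, form a nested base at \<open>0\<close>. A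
product of two elements of \<open>V i\<close> stays there because the factor of lower level already belongs to
the stage \<open>X j\<close> at which the other factor is new. A fixed \<open>x\<close> lies in some stage \<open>X i\<close>, so that
multiplication by \<open>x\<close> preserves \<open>V i\<close> and all smaller neighbourhoods, and \<open>V i\<close> is
disjoint from \<open>X i\<close>, which separates \<open>x\<close> from \<open>0\<close>.\<close>

lemma not_zero_closed_if_filtration:
  fixes r :: "'i rel" and X W :: "'i \<Rightarrow> 'a::semigroup_mult set"
  assumes total: "\<And>i j. (i, j) \<in> r \<or> (j, i) \<in> r" and "trans r"
    and X_mono: "\<And>i j. (i, j) \<in> r \<Longrightarrow> X i \<subseteq> X j" and X_Union: "(\<Union>i. X i) = UNIV"
    and XW: "\<And>i x w. x \<in> X i \<Longrightarrow> w \<in> W i \<Longrightarrow> x * w \<in> W i"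
    and WX: "\<And>i x w. x \<in> X i \<Longrightarrow> w \<in> W i \<Longrightarrow> w * x \<in> W i"
    and WW: "\<And>i v w. v \<in> W i \<Longrightarrow> w \<in> W i \<Longrightarrow> v * w \<in> W i"
    and W_new: "\<And>i. W i \<inter> X i = {}" and W_ne: "\<And>i. W i \<noteq> {}"
    and W_next: "\<And>i j. (i, j) \<in> r \<Longrightarrow> i \<noteq> j \<Longrightarrow> W i \<subseteq> X j"
  shows "\<not> zero_closed TYPE('a)"
proof
  assume zc: "zero_closed TYPE('a)"
  define V where "V i = {w. \<exists>j. (i, j) \<in> r \<and> w \<in> W j}" for i
  have V_mono: "V j \<subseteq> V i" if "(i, j) \<in> r" for i j
    using that transD[OF \<open>trans r\<close>] unfolding V_def by blast
  have V_X: "x * w \<in> V i" "w * x \<in> V i" if "x \<in> X i" "w \<in> V i" for i x w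
  proof -
    obtain j where j: "(i, j) \<in> r" "w \<in> W j"
      using \<open>w \<in> V i\<close> unfolding V_def by blast
    have "x \<in> X j"
      using that(1) X_mono[OF j(1)] by blast
    then have "x * w \<in> W j" "w * x \<in> W j"
      using XW WX j(2) by simp_all
    then show "x * w \<in> V i" "w * x \<in> V i"
      using j(1) unfolding V_def by blast+
  qed
  have V_V: "v * w \<in> V i" if vw: "v \<in> V i" "w \<in> V i" for i v w
  proof -
    obtain j k where j: "(i, j) \<in> r" "v \<in> W j" and k: "(i, k) \<in> r" "w \<in> W k"
      using vw unfolding V_def by auto
    \<comment> \<open>If the levels differ, the factor of lower level is an old element for the other one.\<close>
    consider "j = k" | "(j, k) \<in> r" "j \<noteq> k" | "(k, j) \<in> r" "j \<noteq> k"
      using total by blast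
    then have "v * w \<in> W j \<union> W k"
    proof cases
      case 1
      then show ?thesis using WW[of v j w] j k by simp
    next
      case 2
      then show ?thesis using XW[of v k w] W_next[of j k] j k by blast
    next
      case 3
      then show ?thesis using WX[of w j v] W_next[of k j] j k by blast
    qed
    then show ?thesis using j k unfolding V_def by blast
  qed
  have V_new: "x \<notin> V i" if "x \<in> X i" for i x
    using that X_mono W_new unfolding V_def by blast
  have V_ne: "V i \<noteq> {}" for i
    using W_ne[of i] total[of i i] unfolding V_def by blast

  define nbhd where "nbhd i = insert Zero_new (Elem0 ` V i)" for i
  define T where "T = topology (\<lambda>S. Zero_new \<in> S \<longrightarrow> (\<exists>i. Elem0 ` V i \<subseteq> S))"
  have "istopology (\<lambda>S. Zero_new \<in> S \<longrightarrow> (\<exists>i. Elem0 ` V i \<subseteq> S))"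
    unfolding istopology_def
  proof (intro conjI allI impI)
    fix S S' :: "'a zero_ext set"
    assume *: "Zero_new \<in> S \<longrightarrow> (\<exists>i. Elem0 ` V i \<subseteq> S)" "Zero_new \<in> S' \<longrightarrow> (\<exists>i. Elem0 ` V i \<subseteq> S')"
      and "Zero_new \<in> S \<inter> S'"
    then obtain i j where "Elem0 ` V i \<subseteq> S" "Elem0 ` V j \<subseteq> S'" by blast
    then have "Elem0 ` V i \<subseteq> S \<inter> S' \<or> Elem0 ` V j \<subseteq> S \<inter> S'"
      using total[of i j] V_mono by blast
    then show "\<exists>i. Elem0 ` V i \<subseteq> S \<inter> S'" by blast
  next
    fix K :: "'a zero_ext set set"
    assume *: "\<forall>S\<in>K. Zero_new \<in> S \<longrightarrow> (\<exists>i. Elem0 ` V i \<subseteq> S)" and "Zero_new \<in> \<Union>K"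
    then show "\<exists>i. Elem0 ` V i \<subseteq> \<Union>K" by (meson Union_iff Union_upper subset_trans)
  qed
  then have open_T: "openin T S \<longleftrightarrow> (Zero_new \<in> S \<longrightarrow> (\<exists>i. Elem0 ` V i \<subseteq> S))" for S
    unfolding T_def by (simp add: topology_inverse')
  have "openin T UNIV" by (simp add: open_T)
  then have top: "topspace T = UNIV" by (metis openin_subset top.extremum_uniqueI)
  have open_point: "openin T {Elem0 x}" for x by (simp add: open_T)
  have open_nbhd: "openin T (nbhd i)" for i unfolding open_T nbhd_def by blast
  have "continuous_map (prod_topology T T) T (\<lambda>(x, y). x * y)"
    unfolding continuous_map_def
  proof (intro conjI allI impI)
    fix S assume S: "openin T S"
    let ?P = "{p \<in> topspace (prod_topology T T). (case p of (x, y) \<Rightarrow> x * y) \<in> S}"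
    show "openin (prod_topology T T) ?P"
      unfolding openin_prod_topology_alt
    proof (intro allI impI)
      fix u v assume uv: "(u, v) \<in> ?P"
      then have uvS: "u * v \<in> S" by simp
      have "\<exists>A B. openin T A \<and> openin T B \<and> u \<in> A \<and> v \<in> B \<and> (\<forall>a\<in>A. \<forall>b\<in>B. a * b \<in> S)"
      proof (cases "u * v = Zero_new")
        case False
        then obtain x y where "u = Elem0 x" "v = Elem0 y"
          by (cases u; cases v) (auto simp: times_zero_ext_def)
        then show ?thesis
          using open_point uvS by (intro exI[of _ "{u}"] exI[of _ "{v}"]) auto
      next
        case True
        then obtain i where i: "Elem0 ` V i \<subseteq> S" and Zero: "Zero_new \<in> S"
          using S uvS by (auto simp: open_T)
        then have nbhd_S: "nbhd i \<subseteq> S" unfolding nbhd_def by blast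
        have ex: "\<exists>k. (i, k) \<in> r \<and> x \<in> X k" for x
        proof -
          obtain j where "x \<in> X j" using X_Union by blast
          then show ?thesis using total[of i j] total[of i i] X_mono by blast
        qed
        show ?thesis
        proof (cases u)
          case uZ: Zero_new
          show ?thesis
          proof (cases v)
            case Zero_new
            have "a * b \<in> S" if "a \<in> nbhd i" "b \<in> nbhd i" for a b
              using that nbhd_S V_V[of _ i] Zero
              by (auto simp: nbhd_def times_zero_ext_def split: zero_ext.splits)
            then show ?thesis
              using open_nbhd uZ Zero_new
              by (intro exI[of _ "nbhd i"]) (auto simp: nbhd_def)
          next
            case (Elem0 y)
            obtain k where k: "(i, k) \<in> r" "y \<in> X k" using ex by blast
            have "Elem0 (w * y) \<in> S" if "w \<in> V k" for w
              using V_X(2)[OF k(2) that] V_mono[OF k(1)] i by blast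
            then have "a * v \<in> S" if "a \<in> nbhd k" for a
              using that Zero Elem0
              by (auto simp: nbhd_def times_zero_ext_def)
            then show ?thesis
              using open_nbhd open_point uZ Elem0
              by (intro exI[of _ "nbhd k"] exI[of _ "{v}"]) (auto simp: nbhd_def)
          qed
        next
          case (Elem0 x)
          with True have v: "v = Zero_new"
            by (cases v) (auto simp: times_zero_ext_def)
          obtain k where k: "(i, k) \<in> r" "x \<in> X k" using ex by blast
          have "Elem0 (x * w) \<in> S" if "w \<in> V k" for w
            using V_X(1)[OF k(2) that] V_mono[OF k(1)] i by blast
          then have "u * b \<in> S" if "b \<in> nbhd k" for b
            using that Zero Elem0
            by (auto simp: nbhd_def times_zero_ext_def)
          then show ?thesis
            using open_nbhd open_point v Elem0
            by (intro exI[of _ "{u}"] exI[of _ "nbhd k"]) (auto simp: nbhd_def)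
        qed
      qed
      then obtain A B where "openin T A" "openin T B" "u \<in> A" "v \<in> B" "\<And>a b. a \<in> A \<Longrightarrow> b \<in> B \<Longrightarrow> a * b \<in> S"
        by blast
      moreover from this have "A \<times> B \<subseteq> ?P"
        by (auto simp: top)
      ultimately show "\<exists>A B. openin T A \<and> openin T B \<and> u \<in> A \<and> v \<in> B \<and> A \<times> B \<subseteq> ?P"
        by blast
    qed
  qed (simp add: top)
  then have "semigroup_topology T" by (simp add: semigroup_topology_def top)
  moreover have "Hausdorff_space T"
    unfolding Hausdorff_space_def
  proof (intro allI impI)
    fix u v :: "'a zero_ext"
    assume "u \<in> topspace T \<and> v \<in> topspace T \<and> u \<noteq> v"
    then have "u \<noteq> v" by blast
    have sep: "\<exists>i. Elem0 x \<notin> nbhd i" for x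
    proof -
      obtain i where "x \<in> X i" using X_Union by blast
      then show ?thesis using V_new by (auto simp: nbhd_def)
    qed
    show "\<exists>A B. openin T A \<and> openin T B \<and> u \<in> A \<and> v \<in> B \<and> disjnt A B"
    proof (cases u)
      case uZ: Zero_new
      then obtain y where y: "v = Elem0 y" using \<open>u \<noteq> v\<close> by (cases v) auto
      obtain i where "v \<notin> nbhd i" using sep y by blast
      then show ?thesis
        using uZ y open_nbhd open_point
        by (intro exI[of _ "nbhd i"] exI[of _ "{v}"]) (auto simp: nbhd_def)
    next
      case (Elem0 x)
      show ?thesis
      proof (cases v)
        case Zero_new
        obtain i where "u \<notin> nbhd i" using sep Elem0 by blast
        then show ?thesis
          using Zero_new Elem0 open_nbhd open_point
          by (intro exI[of _ "{u}"] exI[of _ "nbhd i"]) (auto simp: nbhd_def)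
      next
        case (Elem0 y)
        then show ?thesis
          using \<open>u = Elem0 x\<close> \<open>u \<noteq> v\<close> open_point
          by (intro exI[of _ "{u}"] exI[of _ "{v}"]) auto
      qed
    qed
  qed
  \<comment> \<open>If the old points were closed, then 0 would be isolated, although every V i is nonempty.\<close>
  ultimately have "closedin T (range Elem0)"
    using zc unfolding zero_closed_def by blast
  moreover have "UNIV - range Elem0 = {Zero_new :: 'a zero_ext}"
    using zero_ext.exhaust by auto
  ultimately have "openin T {Zero_new}"
    by (metis openin_closedin_eq closedin_def top)
  then show False using V_ne by (auto simp: open_T)
qed

section \<open>Transfinite choice of generic elements\<close>

text \<open>There is no unit to serve as the empty product, so that \<open>list_prod []\<close> is unspecified and the lemmas
speak of nonempty lists.\<close>

fun list_prod :: "'a::semigroup_mult list \<Rightarrow> 'a" where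
  "list_prod [a] = a"
| "list_prod (a # b # l) = a * list_prod (b # l)"

lemma list_prod_Cons: "l \<noteq> [] \<Longrightarrow> list_prod (a # l) = a * list_prod l"
  by (cases l) auto

lemma list_prod_append:
  "k \<noteq> [] \<Longrightarrow> l \<noteq> [] \<Longrightarrow> list_prod (k @ l) = list_prod k * list_prod l"
  by (induction k rule: list_prod.induct) (auto simp: list_prod_Cons mult.assoc)

text \<open>A word in one variable: \<open>None\<close> is the variable and \<open>Some a\<close> is the coefficient \<open>a\<close>. Adjacent
coefficients and adjacent variables are allowed, so that words over a set of generators cover all
polynomials with coefficients in the subsemigroup that it generates, absent coefficients included.\<close>

definition eval_word :: "'a::semigroup_mult \<Rightarrow> 'a option list \<Rightarrow> 'a" where
  "eval_word z l = list_prod (map (case_option z (\<lambda>a. a)) l)"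

lemma eval_word_append:
  "k \<noteq> [] \<Longrightarrow> l \<noteq> [] \<Longrightarrow> eval_word z (k @ l) = eval_word z k * eval_word z l"
  by (simp add: eval_word_def list_prod_append)

lemma eval_word_map_Some: "eval_word z (map Some m) = list_prod m"
  by (simp add: eval_word_def o_def)

lemma card_finite_ordLess_infinite: "finite A \<Longrightarrow> infinite B \<Longrightarrow> |A| <o |B|"
  by (rule finite_ordLess_infinite) (auto simp: card_of_well_order_on Field_card_of)

lemma card_lists_ordLeq:
  assumes "infinite B"
  shows "|lists B| \<le>o |B|"
proof -
  have "|{l \<in> lists B. length l = n}| \<le>o |B|" for n
  proof (induction n)
    case 0
    have "{l \<in> lists B. length l = 0} = {[]}" by auto
    then show ?case using assms by (metis card_of_singl_ordLeq finite.emptyI)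
  next
    case (Suc n)
    have "{l \<in> lists B. length l = Suc n} \<subseteq> (\<lambda>(a, l). a # l) ` (B \<times> {l \<in> lists B. length l = n})"
      by (auto simp: length_Suc_conv image_iff)
    then have "|{l \<in> lists B. length l = Suc n}| \<le>o |B \<times> {l \<in> lists B. length l = n}|"
      by (rule surj_imp_ordLeq)
    moreover have "|B \<times> {l \<in> lists B. length l = n}| \<le>o |B|"
      using Suc assms by (intro card_of_Sigma_ordLeq_infinite) (simp_all add: card_of_mono1)
    ultimately show ?case using ordLeq_transitive by blast
  qed
  moreover have "|UNIV :: nat set| \<le>o |B|" using assms infinite_iff_card_of_nat by blast
  ultimately have "|\<Union>n. {l \<in> lists B. length l = n}| \<le>o |B|"
    by (intro card_of_UNION_ordLeq_infinite[OF assms] ballI)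
  moreover have "(\<Union>n. {l \<in> lists B. length l = n}) = lists B" by auto
  ultimately show ?thesis by simp
qed

text \<open>Fewer than continuum many elements \<open>A\<close> give fewer than continuum many equations
between a word in which the unknown occurs and a word of coefficients. Each has finitely many solutions among the continuum many
candidates \<open>\<zeta> t\<close>, so one candidate solves none of them.\<close>

lemma ex_generic:
  fixes E :: "'a::semigroup_mult rel" and \<zeta> :: "nat set \<Rightarrow> 'a"
  assumes fin: "\<And>l g. None \<in> set l \<Longrightarrow> finite {t. (eval_word (\<zeta> t) l, g) \<in> E}"
    and A: "|A| <o |UNIV :: nat set set|"
  shows "\<exists>z. \<forall>l m. set l \<subseteq> insert None (Some ` A) \<longrightarrow> None \<in> set l \<longrightarrow> set m \<subseteq> A \<longrightarrow>
           (eval_word z l, list_prod m) \<notin> E"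
proof -
  define M where "M = A <+> (UNIV :: nat set)"
  define I where "I = {l \<in> lists (insert None (Some ` A)). None \<in> set l} \<times> lists A"
  have inf: "infinite M" unfolding M_def by (simp add: finite_Plus_iff)
  have c_inf: "infinite (UNIV :: nat set set)" by (simp add: Finite_Set.finite_set)
  have "|UNIV :: nat set| <o |UNIV :: nat set set|" using card_of_Pow[of "UNIV :: nat set"] by simp
  then have M_less: "|M| <o |UNIV :: nat set set|"
    unfolding M_def using card_of_Plus_ordLess_infinite c_inf A by blast
  \<comment> \<open>Letters are coded in M: Inl a stands for the coefficient a and every Inr for the variable.\<close>
  have "lists (insert None (Some ` A)) \<subseteq> map (case_sum Some (\<lambda>_. None)) ` lists M"
    unfolding lists_image[symmetric] M_def by (rule lists_mono) force
  then have "|{l \<in> lists (insert None (Some ` A)). None \<in> set l}| \<le>o |lists M|"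
    by (intro surj_imp_ordLeq[where f = "map (case_sum Some (\<lambda>_. None))"]) blast
  moreover have "lists A \<subseteq> map projl ` lists M"
    unfolding lists_image[symmetric] M_def by (rule lists_mono) force
  then have "|lists A| \<le>o |lists M|" by (rule surj_imp_ordLeq)
  ultimately have "|I| \<le>o |M|"
    unfolding I_def using card_lists_ordLeq[OF inf] inf
    by (intro card_of_Sigma_ordLeq_infinite) (auto intro: ordLeq_transitive)
  moreover have "|{t. (eval_word (\<zeta> t) (fst p), list_prod (snd p)) \<in> E}| \<le>o |M|" if "p \<in> I" for p
  proof -
    have "finite {t. (eval_word (\<zeta> t) (fst p), list_prod (snd p)) \<in> E}"
      using that by (intro fin) (auto simp: I_def)
    then show ?thesis using inf card_finite_ordLess_infinite ordLess_imp_ordLeq by blast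
  qed
  ultimately have "|\<Union>p\<in>I. {t. (eval_word (\<zeta> t) (fst p), list_prod (snd p)) \<in> E}| \<le>o |M|"
    by (intro card_of_UNION_ordLeq_infinite[OF inf] ballI)
  then have "(\<Union>p\<in>I. {t. (eval_word (\<zeta> t) (fst p), list_prod (snd p)) \<in> E}) \<noteq> UNIV"
    using M_less not_ordLess_ordLeq by metis
  then obtain t where t: "\<And>p. p \<in> I \<Longrightarrow> (eval_word (\<zeta> t) (fst p), list_prod (snd p)) \<notin> E" by blast
  show ?thesis
  proof (intro exI[of _ "\<zeta> t"] allI impI)
    fix l m assume "set l \<subseteq> insert None (Some ` A)" "None \<in> set l" "set m \<subseteq> A"
    then show "(eval_word (\<zeta> t) l, list_prod m) \<notin> E"
      using t[of "(l, m)"] by (simp add: I_def in_lists_conv_set subset_iff)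
  qed
qed

text \<open>The filtration is built by recursion along a well-order of type continuum on the codes. Stage \<open>s\<close> is
generated, up to the congruence, by representatives of the classes with codes up to \<open>s\<close> and by the
elements \<open>z i\<close> chosen before; it has fewer than continuum many generators, whence a generic \<open>z s\<close>
can be chosen. The new elements \<open>W s\<close> are the words in which \<open>z s\<close> occurs, and genericity says that
none of them falls back into the stage. Working up to a congruence with at most continuum many
classes is what lets the recursion exhaust a semigroup of arbitrary cardinality.\<close>

lemma not_zero_closed_if_few_solutions:
  fixes E :: "'a::semigroup_mult rel" and code :: "'a \<Rightarrow> nat set" and \<zeta> :: "nat set \<Rightarrow> 'a"
  assumes E: "equiv UNIV E"
    and cong: "\<And>x y u v. (x, y) \<in> E \<Longrightarrow> (u, v) \<in> E \<Longrightarrow> (x * u, y * v) \<in> E"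
    and code: "\<And>x y. code x = code y \<Longrightarrow> (x, y) \<in> E"
    and fin: "\<And>l g. None \<in> set l \<Longrightarrow> finite {t. (eval_word (\<zeta> t) l, g) \<in> E}"
  shows "\<not> zero_closed TYPE('a)"
proof -
  define r where "r = |UNIV :: nat set set|"
  have wo: "Well_order r" and co: "Card_order r" and Field_r: "Field r = UNIV"
    unfolding r_def by (rule card_of_Well_order, rule card_of_Card_order, rule Field_card_of)
  have "wf (r - Id)" "trans r" "Total r" "Refl r" "antisym r"
    using wo by (auto simp: well_order_on_def linear_order_on_def partial_order_on_def preorder_on_def)
  have total: "(i, j) \<in> r \<or> (j, i) \<in> r" for i j
  proof (cases "i = j")
    case True
    then show ?thesis using refl_onD[OF \<open>Refl r\<close>] Field_r by simp
  next
    case False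
    then show ?thesis using \<open>Total r\<close> unfolding total_on_def Field_r by simp
  qed
  have E_sym: "(y, x) \<in> E" if "(x, y) \<in> E" for x y using E that by (meson equivE symD)
  have E_trans: "(x, z) \<in> E" if "(x, y) \<in> E" "(y, z) \<in> E" for x y z
    using E that by (meson equivE transD)
  have E_refl: "(x, x) \<in> E" for x using E by (meson UNIV_I equivE refl_onD)

  define rep where "rep c = (SOME x. code x = c)" for c
  have rep: "(x, rep (code x)) \<in> E" for x
    by (rule code) (metis (mono_tags, lifting) rep_def someI)
  \<comment> \<open>The representative of s itself is included, so that every x is caught at stage code x.\<close>
  define A where "A g s = rep ` insert s (underS r s) \<union> g ` underS r s" for g s
  have "\<exists>g. \<forall>s. \<forall>l m. set l \<subseteq> insert None (Some ` A g s) \<longrightarrow> None \<in> set l \<longrightarrow> set m \<subseteq> A g s \<longrightarrow>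
                 (eval_word (g s) l, list_prod m) \<notin> E"
  proof (rule dependent_wf_choice[OF \<open>wf (r - Id)\<close>])
    fix f g :: "nat set \<Rightarrow> 'a" and s z
    assume "\<And>i. (i, s) \<in> r - Id \<Longrightarrow> f i = g i"
    then have "f ` underS r s = g ` underS r s" by (auto simp: underS_def image_iff)
    then have "A f s = A g s" unfolding A_def by simp
    then show "(\<forall>l m. set l \<subseteq> insert None (Some ` A f s) \<longrightarrow> None \<in> set l \<longrightarrow> set m \<subseteq> A f s \<longrightarrow>
                 (eval_word z l, list_prod m) \<notin> E) =
          (\<forall>l m. set l \<subseteq> insert None (Some ` A g s) \<longrightarrow> None \<in> set l \<longrightarrow> set m \<subseteq> A g s \<longrightarrow>
                 (eval_word z l, list_prod m) \<notin> E)" by simp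
  next
    fix s and g :: "nat set \<Rightarrow> 'a"
    have c_inf: "infinite (UNIV :: nat set set)" by (simp add: Finite_Set.finite_set)
    have less: "|underS r s| <o |UNIV :: nat set set|"
      using card_of_underS[OF co] Field_r unfolding r_def by blast
    have "|{s}| <o |UNIV :: nat set set|"
      using c_inf by (intro card_finite_ordLess_infinite) auto
    have "|insert s (underS r s)| <o |UNIV :: nat set set|"
      using card_of_Un_ordLess_infinite[OF c_inf \<open>|{s}| <o _\<close> less] by simp
    then have "|A g s| <o |UNIV :: nat set set|"
      unfolding A_def using card_of_image less
      by (intro card_of_Un_ordLess_infinite[OF c_inf]) (blast intro: ordLeq_ordLess_trans)+
    then show "\<exists>z. \<forall>l m. set l \<subseteq> insert None (Some ` A g s) \<longrightarrow> None \<in> set l \<longrightarrow> set m \<subseteq> A g s \<longrightarrow>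
                 (eval_word z l, list_prod m) \<notin> E"
      using ex_generic[OF fin] by blast
  qed
  then obtain z where z: "\<And>s l m. set l \<subseteq> insert None (Some ` A z s) \<Longrightarrow> None \<in> set l \<Longrightarrow>
      set m \<subseteq> A z s \<Longrightarrow> (eval_word (z s) l, list_prod m) \<notin> E"
    by blast
  define X where "X s = {y. \<exists>m. m \<noteq> [] \<and> set m \<subseteq> A z s \<and> (y, list_prod m) \<in> E}" for s
  define W where "W s = {w. \<exists>l. None \<in> set l \<and> set l \<subseteq> insert None (Some ` A z s) \<and>
                             (w, eval_word (z s) l) \<in> E}" for s
  have W_I: "w \<in> W s" if "(w, eval_word (z s) l) \<in> E" "None \<in> set l" "set l \<subseteq> insert None (Some ` A z s)" for w s l
    using that unfolding W_def by blast
  have A_mono: "A z i \<subseteq> A z j" if "(i, j) \<in> r" for i j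
  proof -
    have "underS r i \<subseteq> underS r j"
      using that \<open>trans r\<close> \<open>antisym r\<close> unfolding underS_def by (auto dest: transD antisymD)
    moreover have "insert i (underS r i) \<subseteq> insert j (underS r j)"
      using that calculation unfolding underS_def by auto
    ultimately show ?thesis unfolding A_def by blast
  qed
  have z_A: "z i \<in> A z j" if "(i, j) \<in> r" "i \<noteq> j" for i j
    using that unfolding A_def underS_def by blast
  show ?thesis
  proof (rule not_zero_closed_if_filtration[where r = r and X = X and W = W])
    show "X i \<subseteq> X j" if "(i, j) \<in> r" for i j
      using A_mono[OF that] unfolding X_def by blast
    have "x \<in> X (code x)" for x
      unfolding X_def A_def using rep[of x] by (auto intro!: exI[of _ "[rep (code x)]"])
    then show "(\<Union>i. X i) = UNIV" by blast
    show "x * w \<in> W i" "w * x \<in> W i" if xw: "x \<in> X i" "w \<in> W i" for i x w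
    proof -
      obtain m where m: "m \<noteq> []" "set m \<subseteq> A z i" "(x, list_prod m) \<in> E"
        using xw unfolding X_def by blast
      obtain l where l: "None \<in> set l" "set l \<subseteq> insert None (Some ` A z i)" "(w, eval_word (z i) l) \<in> E"
        using xw unfolding W_def by blast
      have "l \<noteq> []" using l by auto
      have "(x * w, eval_word (z i) (map Some m @ l)) \<in> E" "(w * x, eval_word (z i) (l @ map Some m)) \<in> E"
        using m l \<open>l \<noteq> []\<close> cong by (simp_all add: eval_word_append eval_word_map_Some)
      moreover have "set (map Some m) \<subseteq> insert None (Some ` A z i)"
        using image_mono[OF m(2), of Some] by (simp add: subset_insertI2)
      ultimately show "x * w \<in> W i" "w * x \<in> W i"
        using l(1,2) W_I[of "x * w" i "map Some m @ l"] W_I[of "w * x" i "l @ map Some m"] by simp_all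
    qed
    show "v * w \<in> W i" if vw: "v \<in> W i" "w \<in> W i" for i v w
    proof -
      obtain k where k: "None \<in> set k" "set k \<subseteq> insert None (Some ` A z i)" "(v, eval_word (z i) k) \<in> E"
        using vw unfolding W_def by blast
      obtain l where l: "None \<in> set l" "set l \<subseteq> insert None (Some ` A z i)" "(w, eval_word (z i) l) \<in> E"
        using vw unfolding W_def by blast
      have "k \<noteq> []" "l \<noteq> []" using k l by auto
      then have "(v * w, eval_word (z i) (k @ l)) \<in> E" using k l cong by (simp add: eval_word_append)
      then show ?thesis using k(1,2) l(1,2) W_I[of "v * w" i "k @ l"] by simp
    qed
    show "W i \<inter> X i = {}" for i
    proof (rule ccontr)
      assume "W i \<inter> X i \<noteq> {}"
      then obtain w l m where "None \<in> set l" "set l \<subseteq> insert None (Some ` A z i)"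
          "(w, eval_word (z i) l) \<in> E" "set m \<subseteq> A z i" "(w, list_prod m) \<in> E"
        unfolding W_def X_def by blast
      then show False using z E_sym E_trans by blast
    qed
    show "W i \<noteq> {}" for i
      using W_I[OF E_refl, of "[None]"] by auto
    show "W i \<subseteq> X j" if ij: "(i, j) \<in> r" "i \<noteq> j" for i j
    proof
      fix w assume "w \<in> W i"
      then obtain l where l: "None \<in> set l" "set l \<subseteq> insert None (Some ` A z i)" "(w, eval_word (z i) l) \<in> E"
        unfolding W_def by blast
      define m where "m = map (case_option (z i) (\<lambda>a. a)) l"
      have "insert None (Some ` A z i) \<subseteq> insert None (Some ` A z j)" using A_mono[OF ij(1)] by blast
      then have "set l \<subseteq> insert None (Some ` A z j)" using l(2) by (rule order_trans[rotated])
      then have "set m \<subseteq> A z j" using z_A[OF ij] unfolding m_def by (auto split: option.splits)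
      moreover have "m \<noteq> []" using l(1) unfolding m_def by auto
      ultimately show "w \<in> X j"
        using l(3) unfolding X_def eval_word_def m_def[symmetric] by blast
    qed
  qed (use total \<open>trans r\<close> in auto)
qed

section \<open>A Cantor scheme in compact Hausdorff spaces\<close>

text \<open>The usual perfect set construction: a binary tree of open sets whose closures are nested, where at
a node of level \<open>n\<close> no point of one child is \<open>R n\<close>-related to a point of the other. Two branches that split at
level \<open>k\<close> yield points not related by \<open>R k\<close>, hence by no \<open>R n\<close> with \<open>n\<close> at most \<open>k\<close>. Compactness
gives a point on each branch.\<close>

lemma cantor_scheme:
  fixes R :: "nat \<Rightarrow> ('a \<times> 'a) set"
  assumes "compact_space T" "Hausdorff_space T" "topspace T \<noteq> {}"
    and closed: "\<And>n. closedin (prod_topology T T) (R n)"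
    and mono: "\<And>m n. m \<le> n \<Longrightarrow> R m \<subseteq> R n"
    and sym: "\<And>n x y. (x, y) \<in> R n \<Longrightarrow> (y, x) \<in> R n"
    and thin: "\<And>n W. openin T W \<Longrightarrow> W \<noteq> {} \<Longrightarrow> \<exists>x\<in>W. \<exists>y\<in>W. (x, y) \<notin> R n"
  obtains \<zeta> :: "nat set \<Rightarrow> 'a"
  where "\<And>t. \<zeta> t \<in> topspace T"
    and "\<And>s t n. (\<zeta> s, \<zeta> t) \<in> R n \<Longrightarrow> s \<inter> {..<n} = t \<inter> {..<n} \<Longrightarrow> s = t"
proof -
  have "regular_space T"
    using assms(1,2) by (rule compact_Hausdorff_imp_regular_space)
  then have shrink: "\<exists>U. openin T U \<and> x \<in> U \<and> T closure_of U \<subseteq> W" if "openin T W" "x \<in> W" for W x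
  proof -
    have "closedin T (topspace T - W)" "x \<in> topspace T - (topspace T - W)"
      using that openin_subset by (auto simp: openin_closedin_eq)
    then obtain U where "openin T U" "x \<in> U" "disjnt (topspace T - W) (T closure_of U)"
      using \<open>regular_space T\<close> unfolding regular_space by blast
    then show ?thesis
      using closure_of_subset_topspace[of T U] unfolding disjnt_def by blast
  qed
  define good where "good n W U V \<longleftrightarrow> openin T U \<and> openin T V \<and> U \<noteq> {} \<and> V \<noteq> {} \<and>
      T closure_of U \<subseteq> W \<and> T closure_of V \<subseteq> W \<and> U \<times> V \<inter> R n = {}" for n W U V
  have ex_good: "\<exists>p. good n W (fst p) (snd p)"
    if W: "openin T W" "W \<noteq> {}" for n W
  proof -
    obtain x y where xy: "x \<in> W" "y \<in> W" "(x, y) \<notin> R n" using thin[OF W] by blast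
    have "openin (prod_topology T T) (topspace (prod_topology T T) - R n)"
      using closed by blast
    moreover have "(x, y) \<in> topspace (prod_topology T T) - R n"
      using xy openin_subset[OF W(1)] by auto
    ultimately obtain U V where UV: "openin T U" "openin T V" "x \<in> U" "y \<in> V"
        and "U \<times> V \<subseteq> topspace (prod_topology T T) - R n"
      unfolding openin_prod_topology_alt by metis
    then have dis: "U \<times> V \<inter> R n = {}" by blast
    obtain U' where U': "openin T U'" "x \<in> U'" "T closure_of U' \<subseteq> U \<inter> W"
      using shrink[of "U \<inter> W" x] UV xy W by blast
    obtain V' where V': "openin T V'" "y \<in> V'" "T closure_of V' \<subseteq> V \<inter> W"
      using shrink[of "V \<inter> W" y] UV xy W by blast
    have "U' \<subseteq> U" "V' \<subseteq> V"
      using U'(3) V'(3) closure_of_subset[OF openin_subset[OF U'(1)]] closure_of_subset[OF openin_subset[OF V'(1)]]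
      by blast+
    then have "U' \<times> V' \<inter> R n = {}" using dis by blast
    moreover have "T closure_of U' \<subseteq> W" "T closure_of V' \<subseteq> W" using U' V' by blast+
    ultimately show ?thesis
      using U' V' unfolding good_def by (intro exI[of _ "(U', V')"]) auto
  qed
  define P where "P n W = (SOME p. good n W (fst p) (snd p))" for n W
  have P: "openin T (fst (P n W)) \<and> openin T (snd (P n W)) \<and> fst (P n W) \<noteq> {} \<and> snd (P n W) \<noteq> {} \<and>
      T closure_of (fst (P n W)) \<subseteq> W \<and> T closure_of (snd (P n W)) \<subseteq> W \<and>
      fst (P n W) \<times> snd (P n W) \<inter> R n = {}" if "openin T W" "W \<noteq> {}" for n W
    using someI_ex[OF ex_good[OF that]] unfolding P_def good_def .
  define C where "C t = rec_nat (topspace T) (\<lambda>n W. (if n \<in> t then snd else fst) (P n W))"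
    for t :: "nat set"
  have C_0: "C t 0 = topspace T" and
    C_Suc: "C t (Suc n) = (if n \<in> t then snd else fst) (P n (C t n))" for t n
    unfolding C_def by simp_all
  have C: "openin T (C t n)" "C t n \<noteq> {}" for t n
    by (induction n) (use P assms(3) in \<open>auto simp: C_0 C_Suc\<close>)
  have C_closure: "T closure_of (C t (Suc n)) \<subseteq> C t n" for t n
    using P[OF C] by (simp add: C_Suc)
  have C_sub: "C t n \<subseteq> T closure_of (C t n)" for t n
    using C(1) by (simp add: closure_of_subset openin_subset)
  have "(\<Inter>n. T closure_of (C t n)) \<noteq> {}" for t
  proof (rule compact_space_imp_nest[OF \<open>compact_space T\<close>])
    show "T closure_of (C t n) \<noteq> {}" for n using C(2) C_sub by blast
    show "decseq (\<lambda>n. T closure_of (C t n))"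
      unfolding decseq_Suc_iff using C_closure C_sub by blast
  qed auto
  then have "\<forall>t. \<exists>x. \<forall>n. x \<in> T closure_of (C t n)" by blast
  then obtain \<zeta> where "\<And>t n. \<zeta> t \<in> T closure_of (C t n)"
    using choice[of "\<lambda>t x. \<forall>n. x \<in> T closure_of (C t n)"] by blast
  then have \<zeta>: "\<zeta> t \<in> C t n" for t n using C_closure by blast
  show ?thesis
  proof
    show "\<zeta> t \<in> topspace T" for t using \<zeta>[of t 0] by (simp add: C_0)
    \<comment> \<open>At the first place k of disagreement the two points lie in the two children of the same node.\<close>
    show "s = t" if R: "(\<zeta> s, \<zeta> t) \<in> R n" and eq: "s \<inter> {..<n} = t \<inter> {..<n}" for s t n
    proof (rule ccontr)
      assume "s \<noteq> t"
      then have ex: "\<exists>k. (k \<in> s) \<noteq> (k \<in> t)" by blast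
      define k where "k = (LEAST k. (k \<in> s) \<noteq> (k \<in> t))"
      have k: "(k \<in> s) \<noteq> (k \<in> t)" unfolding k_def using ex by (rule LeastI_ex)
      have less_k: "(j \<in> s) = (j \<in> t)" if "j < k" for j
        using that not_less_Least unfolding k_def by blast
      have "n \<le> k"
        using k eq by (metis IntD1 IntI lessThan_iff not_le)
      have "C s j = C t j" if "j \<le> k" for j
        using that by (induction j) (auto simp: C_0 C_Suc less_k)
      then have Ck: "C s k = C t k" by simp
      have dis: "fst (P k (C s k)) \<times> snd (P k (C s k)) \<inter> R k = {}"
        using P[OF C[of s k], of k] by blast
      have "(\<zeta> s, \<zeta> t) \<in> R k" "(\<zeta> t, \<zeta> s) \<in> R k"
        using R sym mono[OF \<open>n \<le> k\<close>] by blast+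
      then show False
        using dis \<zeta>[of s "Suc k"] \<zeta>[of t "Suc k"] k Ck by (auto simp: C_Suc split: if_splits)
    qed
  qed
qed

section \<open>Maximal groups in compact semigroups\<close>

text \<open>Zorn's lemma for closed sets; compactness makes the intersection of a chain nonempty.\<close>

lemma ex_minimal_closed_set:
  assumes "compact_space T" and S: "closedin T S" "S \<noteq> {}" "P S"
    and P_Inter: "\<And>\<C>. \<C> \<noteq> {} \<Longrightarrow> (\<And>C. C \<in> \<C> \<Longrightarrow> P C) \<Longrightarrow> P (\<Inter>\<C>)"
  obtains M where "closedin T M" "M \<noteq> {}" "P M" "M \<subseteq> S"
    and "\<And>N. closedin T N \<Longrightarrow> N \<noteq> {} \<Longrightarrow> P N \<Longrightarrow> N \<subseteq> M \<Longrightarrow> N = M"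
proof -
  define \<F> where "\<F> = {C. closedin T C \<and> C \<noteq> {} \<and> P C \<and> C \<subseteq> S}"
  have "\<exists>M\<in>uminus ` \<F>. \<forall>X\<in>uminus ` \<F>. M \<subseteq> X \<longrightarrow> X = M"
  proof (rule subset_Zorn_nonempty)
    show "uminus ` \<F> \<noteq> {}" using S by (auto simp: \<F>_def)
    fix \<D> :: "'a set set" assume "\<D> \<noteq> {}" and chain: "subset.chain (uminus ` \<F>) \<D>"
    define \<C> where "\<C> = uminus ` \<D>"
    have \<D>: "\<D> = uminus ` \<C>" unfolding \<C>_def by (auto simp: image_image)
    have \<C>_ne: "\<C> \<noteq> {}" using \<open>\<D> \<noteq> {}\<close> \<C>_def by simp
    have "\<D> \<subseteq> uminus ` \<F>" using chain by (simp add: subset.chain_def)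
    then have \<C>_F: "\<C> \<subseteq> \<F>" unfolding \<C>_def by auto
    have "subset.chain UNIV \<C>"
      using chain unfolding subset_chain_def \<C>_def by auto
    then have "\<Inter>\<B> \<noteq> {}" if "finite \<B>" "\<B> \<subseteq> \<C>" for \<B>
    proof (cases "\<B> = {}")
      case False
      moreover have "subset.chain UNIV \<B>"
        using \<open>subset.chain UNIV \<C>\<close> that by (auto simp: subset_chain_def)
      ultimately have "\<Inter>\<B> \<in> \<B>" using Inter_in_chain that by blast
      then show ?thesis using that \<C>_F by (auto simp: \<F>_def)
    qed simp
    moreover have "closedin T C" if "C \<in> \<C>" for C using that \<C>_F by (auto simp: \<F>_def)
    ultimately have "(\<forall>C\<in>\<C>. closedin T C) \<and> (\<forall>\<B>. finite \<B> \<and> \<B> \<subseteq> \<C> \<longrightarrow> \<Inter>\<B> \<noteq> {})"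
      by simp
    then have "\<Inter>\<C> \<noteq> {}"
      by (rule compact_space_fip[THEN iffD1, OF \<open>compact_space T\<close>, THEN spec, THEN mp])
    moreover have "closedin T (\<Inter>\<C>)"
      using \<C>_ne \<C>_F by (intro closedin_Inter) (auto simp: \<F>_def)
    moreover have "P (\<Inter>\<C>)"
      using \<C>_ne \<C>_F by (intro P_Inter) (auto simp: \<F>_def)
    moreover have "\<Inter>\<C> \<subseteq> S" using \<C>_ne \<C>_F by (auto simp: \<F>_def)
    ultimately have "\<Inter>\<C> \<in> \<F>" by (simp add: \<F>_def)
    moreover have "\<Union>\<D> = - \<Inter>\<C>" unfolding \<D> by auto
    ultimately show "\<Union>\<D> \<in> uminus ` \<F>" by blast
  qed
  then obtain M where "M \<in> \<F>" and "\<And>N. N \<in> \<F> \<Longrightarrow> N \<subseteq> M \<Longrightarrow> N = M" by auto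
  then show ?thesis using that[of M] unfolding \<F>_def by auto
qed

locale compact_semigroup =
  fixes T :: "'a::semigroup_mult topology"
  assumes semigroup_topology: "semigroup_topology T"
    and compact_space: "compact_space T"
    and Hausdorff_space: "Hausdorff_space T"
begin

lemma topspace_eq_UNIV [simp]: "topspace T = UNIV"
  using semigroup_topology by (simp add: semigroup_topology_def)

lemma continuous_map_mult [continuous_intros]:
  assumes "continuous_map Z T f" "continuous_map Z T g"
  shows "continuous_map Z T (\<lambda>z. f z * g z)"
proof -
  have "continuous_map (prod_topology T T) T (\<lambda>(x, y). x * y)"
    using semigroup_topology by (simp add: semigroup_topology_def)
  from continuous_map_compose[OF continuous_map_pairedI[OF assms] this]
  show ?thesis by (simp add: o_def)
qed

lemma compactin_iff_closedin: "compactin T S \<longleftrightarrow> closedin T S"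
  using compact_space Hausdorff_space by (auto intro: closedin_compact_space compactin_imp_closedin)

lemma closedin_point: "closedin T {x}"
  by (simp add: Hausdorff_space closedin_Hausdorff_singleton)

lemma closedin_mult_image: "closedin T S \<Longrightarrow> closedin T ((\<lambda>x. a * x * b) ` S)"
  unfolding compactin_iff_closedin[symmetric]
  by (erule image_compactin) (intro continuous_intros continuous_map_id[unfolded id_def]; simp)

lemma closedin_right_mult_image: "closedin T S \<Longrightarrow> closedin T ((\<lambda>x. x * b) ` S)"
  unfolding compactin_iff_closedin[symmetric]
  by (erule image_compactin) (intro continuous_intros continuous_map_id[unfolded id_def]; simp)

text \<open>A minimal closed subsemigroup \<open>M\<close> consists of idempotents: for \<open>s\<close> in \<open>M\<close>, minimality
gives \<open>M s = M\<close>, so that the closed subsemigroup of those \<open>x\<close> in \<open>M\<close> with \<open>x s = s\<close> is nonempty and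
equals \<open>M\<close> as well. (Ellis, Numakura)\<close>

lemma ex_idempotent:
  assumes "closedin T S" "S \<noteq> {}" "\<And>x y. x \<in> S \<Longrightarrow> y \<in> S \<Longrightarrow> x * y \<in> S"
  obtains e where "e \<in> S" "e * e = e"
proof -
  obtain M where M: "closedin T M" "M \<noteq> {}" "\<forall>x\<in>M. \<forall>y\<in>M. x * y \<in> M" "M \<subseteq> S"
    and minimal: "\<And>N. closedin T N \<Longrightarrow> N \<noteq> {} \<Longrightarrow> \<forall>x\<in>N. \<forall>y\<in>N. x * y \<in> N \<Longrightarrow> N \<subseteq> M \<Longrightarrow> N = M"
    by (rule ex_minimal_closed_set[OF compact_space assms(1,2), of "\<lambda>M. \<forall>x\<in>M. \<forall>y\<in>M. x * y \<in> M"])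
      (use assms(3) in auto)
  obtain s where s: "s \<in> M" using M(2) by blast
  have "(\<lambda>x. x * s) ` M = M"
  proof (rule minimal)
    show "closedin T ((\<lambda>x. x * s) ` M)" using M(1) by (rule closedin_right_mult_image)
    show "\<forall>x\<in>(\<lambda>x. x * s) ` M. \<forall>y\<in>(\<lambda>x. x * s) ` M. x * y \<in> (\<lambda>x. x * s) ` M"
    proof (intro ballI)
      fix x y assume "x \<in> (\<lambda>x. x * s) ` M" "y \<in> (\<lambda>x. x * s) ` M"
      then obtain x' y' where xy: "x = x' * s" "y = y' * s" "x' \<in> M" "y' \<in> M" by blast
      then have "x * y = (x' * s * y') * s" by (simp add: mult.assoc)
      moreover have "x' * s * y' \<in> M" using xy s M(3) by blast
      ultimately show "x * y \<in> (\<lambda>x. x * s) ` M" by blast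
    qed
  qed (use M s in auto)
  then obtain u where u: "u \<in> M" "u * s = s" using s by (metis imageE)
  have "{x \<in> M. x * s \<in> {s}} = M"
  proof (rule minimal)
    have "continuous_map T T (\<lambda>x. x * s)"
      by (intro continuous_intros continuous_map_id[unfolded id_def]) simp
    then show "closedin T {x \<in> M. x * s \<in> {s}}"
      using M(1) closedin_point by (intro closedin_continuous_map_preimage_gen)
    show "{x \<in> M. x * s \<in> {s}} \<noteq> {}" using u by blast
    show "\<forall>x\<in>{x \<in> M. x * s \<in> {s}}. \<forall>y\<in>{x \<in> M. x * s \<in> {s}}. x * y \<in> {x \<in> M. x * s \<in> {s}}"
      using M(3) by (auto simp: mult.assoc)
  qed auto
  then have "s * s = s" using s by blast
  then show ?thesis using that M(4) s by blast
qed

text \<open>The idempotent is taken in a minimal closed left ideal \<open>L\<close>. For \<open>x = e x e\<close>, the set of all products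
\<open>y x\<close> is a closed left ideal inside \<open>L\<close>, hence it contains \<open>e\<close>; thus \<open>x\<close> has a left inverse, and left
inverses for all elements of \<open>e X e\<close> make it a group.\<close>

lemma ex_unit_of_maximal_group:
  obtains e :: 'a where "e * e = e"
    and "\<And>x. e * x = x \<Longrightarrow> x * e = x \<Longrightarrow> \<exists>y. e * y = y \<and> y * e = y \<and> y * x = e \<and> x * y = e"
proof -
  obtain L where L: "closedin T L" "L \<noteq> {}" "\<forall>x. \<forall>y\<in>L. x * y \<in> L"
    and minimal: "\<And>N. closedin T N \<Longrightarrow> N \<noteq> {} \<Longrightarrow> \<forall>x. \<forall>y\<in>N. x * y \<in> N \<Longrightarrow> N \<subseteq> L \<Longrightarrow> N = L"
    by (rule ex_minimal_closed_set[OF compact_space, of UNIV "\<lambda>L. \<forall>x. \<forall>y\<in>L. x * y \<in> L"])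
      (use closedin_topspace[of T] in auto)
  obtain e where e: "e \<in> L" "e * e = e"
    using ex_idempotent[OF L(1,2)] L(3) by blast
  have left_inverse: "\<exists>y. e * y = y \<and> y * e = y \<and> y * x = e" if x: "e * x = x" "x * e = x" for x
  proof -
    have "x \<in> L" using L(3) e(1) x(2) by metis
    have "(\<lambda>y. y * x) ` UNIV = L"
    proof (rule minimal)
      show "closedin T ((\<lambda>y. y * x) ` UNIV)"
        using closedin_topspace[of T] by (intro closedin_right_mult_image) simp
      show "\<forall>a. \<forall>b\<in>(\<lambda>y. y * x) ` UNIV. a * b \<in> (\<lambda>y. y * x) ` UNIV"
        by (auto simp: mult.assoc[symmetric])
    qed (use L(3) \<open>x \<in> L\<close> in auto)
    then obtain y where y: "y * x = e" using e(1) by (metis imageE)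
    \<comment> \<open>The left inverse y is arbitrary; compressing it by e moves it into the group.\<close>
    have "(e * y * e) * x = e"
      using x y e by (simp add: mult.assoc)
    moreover have "e * (e * y * e) = e * y * e" "(e * y * e) * e = e * y * e"
      using e(2) by (simp_all add: mult.assoc) (simp add: mult.assoc[symmetric])
    ultimately show ?thesis by blast
  qed
  show ?thesis
  proof (rule that[of e])
    show "e * e = e" by (rule e(2))
    fix x assume x: "e * x = x" "x * e = x"
    obtain y where y: "e * y = y" "y * e = y" "y * x = e" using left_inverse[OF x] by blast
    obtain z where z: "e * z = z" "z * e = z" "z * y = e" using left_inverse[OF y(1,2)] by blast
    have "z = z * (y * x)" using z y by simp
    also have "\<dots> = x" using z x by (simp add: mult.assoc[symmetric])
    finally show "\<exists>y. e * y = y \<and> y * e = y \<and> y * x = e \<and> x * y = e" using y z by blast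
  qed
qed

end

text \<open>The assumptions say that \<open>e X e\<close> is a group. Every polynomial over \<open>X\<close>, compressed by \<open>e\<close> on both
sides, becomes a polynomial over this group, so that the analysis of equations takes place there.\<close>

locale compact_semigroup_with_group = compact_semigroup T
  for T :: "'a::semigroup_mult topology" +
  fixes e :: 'a
  assumes idem [simp]: "e * e = e"
    and ex_inverse: "\<And>x. e * x = x \<Longrightarrow> x * e = x \<Longrightarrow>
      \<exists>y. e * y = y \<and> y * e = y \<and> y * x = e \<and> x * y = e"
begin

definition G :: "'a set" where
  "G = {x. e * x = x \<and> x * e = x}"

lemma G_mult: "x \<in> G \<Longrightarrow> y \<in> G \<Longrightarrow> x * y \<in> G"
  by (simp add: G_def mult.assoc) (metis mult.assoc)

lemma unit_in_G [simp]: "e \<in> G"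
  by (simp add: G_def)

lemma compress_in_G: "e * x * e \<in> G"
  by (simp add: G_def mult.assoc) (metis idem mult.assoc)

lemma G_inverse: "x \<in> G \<Longrightarrow> \<exists>y\<in>G. y * x = e \<and> x * y = e"
  using ex_inverse unfolding G_def by blast

lemma closedin_G: "closedin T G"
proof -
  have "G = (\<lambda>x. e * x * e) ` UNIV"
  proof (intro equalityI subsetI)
    show "x \<in> (\<lambda>x. e * x * e) ` UNIV" if "x \<in> G" for x
      using that by (intro image_eqI[of _ _ x]) (simp_all add: G_def)
  qed (use compress_in_G in auto)
  then show ?thesis using closedin_mult_image[of UNIV] closedin_topspace[of T] by simp
qed

lemma power_mult:
  assumes "x \<in> G" shows "((\<lambda>u. u * x) ^^ (i + j)) e = ((\<lambda>u. u * x) ^^ j) e * ((\<lambda>u. u * x) ^^ i) e"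
proof (induction i)
  case 0
  have "((\<lambda>u. u * x) ^^ j) e \<in> G" using assms by (induction j) (auto intro: G_mult)
  then show ?case by (simp add: G_def)
next
  case (Suc i)
  then show ?case by (simp add: mult.assoc)
qed

lemma power_in_G: "x \<in> G \<Longrightarrow> ((\<lambda>u. u * x) ^^ k) e \<in> G"
  by (induction k) (auto intro: G_mult)

text \<open>The closure of the positive powers of \<open>x\<close> is a closed subsemigroup of the group, so it contains an
idempotent, and the only idempotent of a group is its unit.\<close>

lemma recurrence:
  assumes "openin T W" "e \<in> W" "x \<in> G"
  obtains k where "((\<lambda>u. u * x) ^^ Suc k) e \<in> W"
proof -
  let ?pow = "\<lambda>k. ((\<lambda>u. u * x) ^^ k) e"
  define S where "S = T closure_of (range (\<lambda>k. ?pow (Suc k)))"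
  have "range (\<lambda>k. ?pow (Suc k)) \<subseteq> S"
    unfolding S_def by (rule closure_of_subset) simp
  have "S \<subseteq> G"
    unfolding S_def using power_in_G[OF \<open>x \<in> G\<close>] by (intro closure_of_minimal closedin_G) blast
  have S_mult: "a * b \<in> S" if "a \<in> S" "b \<in> S" for a b
  proof -
    let ?m = "\<lambda>p. fst p * snd p"
    have "continuous_map (prod_topology T T) T ?m"
      by (intro continuous_intros)
    then have "?m ` (prod_topology T T closure_of (range (\<lambda>k. ?pow (Suc k)) \<times> range (\<lambda>k. ?pow (Suc k))))
        \<subseteq> T closure_of ?m ` (range (\<lambda>k. ?pow (Suc k)) \<times> range (\<lambda>k. ?pow (Suc k)))"
      by (rule continuous_map_image_closure_subset)
    also have "\<dots> \<subseteq> S"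
      unfolding S_def
    proof (rule closure_of_mono, safe)
      fix i j
      have "?pow (Suc i) * ?pow (Suc j) = ?pow (Suc (Suc j + i))"
        using power_mult[OF \<open>x \<in> G\<close>, of "Suc j" "Suc i"] by (simp only: add_Suc_right)
      then have "?m (?pow (Suc i), ?pow (Suc j)) = ?pow (Suc (Suc j + i))"
        by (simp only: fst_conv snd_conv)
      then show "?m (?pow (Suc i), ?pow (Suc j)) \<in> range (\<lambda>k. ?pow (Suc k))"
        by (rule range_eqI)
    qed
    finally show ?thesis
      using that unfolding closure_of_Times S_def[symmetric] by force
  qed
  have "closedin T S" "S \<noteq> {}"
    using \<open>range _ \<subseteq> S\<close> by (simp add: S_def, blast)
  then obtain d where d: "d \<in> S" "d * d = d"
    using S_mult by (rule ex_idempotent)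
  obtain y where y: "y * d = e" using G_inverse d \<open>S \<subseteq> G\<close> by blast
  have "d = e * d" using d \<open>S \<subseteq> G\<close> by (auto simp: G_def)
  also have "\<dots> = y * (d * d)" using y by (simp add: mult.assoc[symmetric])
  also have "\<dots> = e" using d y by simp
  finally have "e \<in> T closure_of (range (\<lambda>k. ?pow (Suc k)))" using d unfolding S_def by simp
  then show ?thesis using that assms(1,2) unfolding in_closure_of by blast
qed

end

section \<open>Polynomials over the group\<close>

text \<open>In contrast to semigroup polynomials, all coefficients are present, and constants are admitted as
degree \<open>0\<close>, so that the degree is additive on products and multiplicative on compositions.\<close>

primrec polys :: "'a::semigroup_mult set \<Rightarrow> nat \<Rightarrow> ('a \<Rightarrow> 'a) set" where
  "polys C 0 = {\<lambda>x. a | a. a \<in> C}"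
| "polys C (Suc n) = {\<lambda>x. f x * x * a | f a. f \<in> polys C n \<and> a \<in> C}"

lemma polys_SucI: "f \<in> polys C n \<Longrightarrow> a \<in> C \<Longrightarrow> (\<lambda>x. f x * x * a) \<in> polys C (Suc n)"
  by auto

lemma polys_mult:
  assumes "\<forall>a\<in>C. \<forall>b\<in>C. a * b \<in> C"
  shows "f \<in> polys C n \<Longrightarrow> h \<in> polys C m \<Longrightarrow> (\<lambda>x. f x * h x) \<in> polys C (n + m)"
proof (induction m arbitrary: h)
  case 0
  then obtain b where b: "h = (\<lambda>x. b)" "b \<in> C" by auto
  show ?case
  proof (cases n)
    case 0
    with \<open>f \<in> polys C n\<close> obtain a where "f = (\<lambda>x. a)" "a \<in> C" by auto
    with 0 b assms show ?thesis by auto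
  next
    case (Suc k)
    with \<open>f \<in> polys C n\<close> obtain g a where "f = (\<lambda>x. g x * x * a)" "g \<in> polys C k" "a \<in> C" by auto
    with polys_SucI[of g C k "a * b"] Suc b assms show ?thesis by (simp add: mult.assoc)
  qed
next
  case (Suc m)
  then obtain g a where "h = (\<lambda>x. g x * x * a)" "g \<in> polys C m" "a \<in> C" by auto
  with polys_SucI[of "\<lambda>x. f x * g x" C "n + m" a] Suc show ?case by (simp add: mult.assoc)
qed

lemma polys_compose:
  assumes "\<forall>a\<in>C. \<forall>b\<in>C. a * b \<in> C"
  shows "f \<in> polys C n \<Longrightarrow> h \<in> polys C k \<Longrightarrow> (\<lambda>x. f (h x)) \<in> polys C (n * k)"
proof (induction n arbitrary: f)
  case 0
  then show ?case by auto
next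
  case (Suc n)
  then obtain g a where f: "f = (\<lambda>x. g x * x * a)" and g: "g \<in> polys C n" "a \<in> C" by auto
  have "(\<lambda>x. g (h x) * h x) \<in> polys C (n * k + k)"
    using Suc.IH[OF g(1) Suc.prems(2)] Suc.prems(2) by (rule polys_mult[OF assms])
  moreover have "(\<lambda>x. a) \<in> polys C 0" using g(2) by auto
  ultimately have "(\<lambda>x. g (h x) * h x * a) \<in> polys C (n * k + k + 0)"
    by (rule polys_mult[OF assms])
  then show ?case by (simp add: f add.commute)
qed

lemma poly_word_cong: "(\<And>i. i \<le> n \<Longrightarrow> a i = b i) \<Longrightarrow> poly_word a n x = poly_word b n x"
  by (induction n) auto

lemma polys_imp_poly_word: "f \<in> polys C n \<Longrightarrow> \<exists>a. \<forall>x. Elem1 (f x) = poly_word a n x"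
proof (induction n arbitrary: f)
  case 0
  then obtain c where "f = (\<lambda>x. c)" by auto
  then show ?case by (intro exI[of _ "\<lambda>_. Elem1 c"]) simp
next
  case (Suc n)
  then obtain g c where f: "f = (\<lambda>x. g x * x * c)" and "g \<in> polys C n" by auto
  then obtain a where a: "\<And>x. Elem1 (g x) = poly_word a n x" using Suc.IH by blast
  define b where "b = a(Suc n := Elem1 c)"
  have "poly_word b n x = Elem1 (g x)" for x
    unfolding a by (rule poly_word_cong) (simp add: b_def)
  moreover have "b (Suc n) = Elem1 c" by (simp add: b_def)
  ultimately show ?case
    by (intro exI[of _ b]) (simp add: f times_one_ext_def)
qed

lemma polys_semigroup_polynomial: "f \<in> polys C n \<Longrightarrow> 1 \<le> n \<Longrightarrow> semigroup_polynomial n f"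
  using polys_imp_poly_word by (auto simp: semigroup_polynomial_def)

lemma eval_word_single: "eval_word z [None] = z" "eval_word z [Some a] = a"
  by (simp_all add: eval_word_def)

context compact_semigroup_with_group
begin

lemma polys_in_G: "f \<in> polys G n \<Longrightarrow> x \<in> G \<Longrightarrow> f x \<in> G"
  by (induction n arbitrary: f) (auto intro: G_mult)

text \<open>Since coefficients absorb \<open>e\<close>, a polynomial over the group does not distinguish \<open>x\<close> from \<open>e x e\<close>.
This transfers statements about pairs in the group to arbitrary pairs.\<close>

lemma polys_compress: "f \<in> polys G n \<Longrightarrow> f (e * x * e) = f x \<and> f x * e = f x"
proof (induction n arbitrary: f)
  case 0
  then show ?case by (auto simp: G_def)
next
  case (Suc n)
  then obtain g a where f: "f = (\<lambda>x. g x * x * a)" and g: "g \<in> polys G n" and a: "a \<in> G" by auto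
  have "g x * (e * x * e) * a = (g x * e) * x * (e * a)" by (simp add: mult.assoc)
  then show ?case using Suc.IH[OF g] a by (simp add: f mult.assoc G_def)
qed

lemma polys_left_mult: "f \<in> polys G n \<Longrightarrow> a \<in> G \<Longrightarrow> (\<lambda>x. a * f x) \<in> polys G n"
  using polys_mult[of G "\<lambda>x. a" 0 f n] G_mult by auto

lemma polys_power:
  assumes "w \<in> G" "v \<in> G"
  shows "(\<lambda>x. w * ((\<lambda>u. u * (x * v)) ^^ k) e) \<in> polys G k"
proof (induction k)
  case 0
  then show ?case using assms G_mult by auto
next
  case (Suc k)
  from polys_SucI[OF this assms(2)] show ?case by (simp add: mult.assoc)
qed

text \<open>A variable with value in the group can be surrounded by factors \<open>e\<close>, and these turn the coefficients
between two variables into elements \<open>e a e\<close> of the group. The trailing coefficients after the last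
variable are only compressed on the left; they are kept in \<open>u\<close> until the word is complete, which is
why the induction runs over prefixes.\<close>

lemma compress_word:
  "l \<noteq> [] \<Longrightarrow> \<exists>u. e * u = u \<and> (if None \<in> set l
     then \<exists>n f. f \<in> polys G n \<and> (\<forall>x\<in>G. e * eval_word x l = f x * x * u)
     else \<forall>x\<in>G. e * eval_word x l = u)"
proof (induction l rule: rev_induct)
  case (snoc tok l)
  have end_var: ?case
    if "tok = None" "f \<in> polys G n" "\<forall>x\<in>G. e * eval_word x (l @ [tok]) = f x * x * e" for n f
  proof -
    have "\<exists>n f. f \<in> polys G n \<and> (\<forall>x\<in>G. e * eval_word x (l @ [tok]) = f x * x * e)"
      using that by blast
    then show ?thesis using that(1) by (intro exI[of _ e]) simp
  qed
  show ?case
  proof (cases "l = []")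
    case True
    show ?thesis
    proof (cases tok)
      case None
      have "(\<lambda>x. e) \<in> polys G 0" by auto
      moreover have "\<forall>x\<in>G. e * eval_word x (l @ [tok]) = e * x * e"
        using True None by (simp add: eval_word_def G_def mult.assoc)
      ultimately show ?thesis using None by (intro end_var)
    next
      case (Some a)
      then show ?thesis
        using True by (intro exI[of _ "e * a"]) (simp add: eval_word_def mult.assoc[symmetric])
    qed
  next
    case False
    then obtain u where u: "e * u = u" and step: "if None \<in> set l
       then \<exists>n f. f \<in> polys G n \<and> (\<forall>x\<in>G. e * eval_word x l = f x * x * u)
       else \<forall>x\<in>G. e * eval_word x l = u"
      using snoc.IH by blast
    have eval: "e * eval_word x (l @ [t]) = e * eval_word x l * eval_word x [t]" for x t
      using False by (simp add: eval_word_append mult.assoc)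
    have ueG: "u * e \<in> G" using u by (simp add: G_def mult.assoc[symmetric]) (simp add: mult.assoc)
    have absorb: "u * x = (u * e) * x * e" if "x \<in> G" for x
      using that by (simp add: G_def mult.assoc)
    show ?thesis
    proof (cases tok)
      case None
      show ?thesis
      proof (cases "None \<in> set l")
        case True
        then obtain n f where f: "f \<in> polys G n" "\<forall>x\<in>G. e * eval_word x l = f x * x * u"
          using step by auto
        have "\<forall>x\<in>G. e * eval_word x (l @ [tok]) = (f x * x * (u * e)) * x * e"
        proof
          fix x assume x: "x \<in> G"
          have "e * eval_word x (l @ [tok]) = (e * eval_word x l) * x"
            using None by (simp only: eval eval_word_single)
          also have "\<dots> = f x * x * (u * x)"
            using f(2) x by (simp add: mult.assoc)
          also have "\<dots> = f x * x * ((u * e) * x * e)" using absorb[OF x] by simp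
          finally show "e * eval_word x (l @ [tok]) = (f x * x * (u * e)) * x * e"
            by (simp add: mult.assoc)
        qed
        then show ?thesis
          using None polys_SucI[OF f(1) ueG] by (intro end_var)
      next
        case False
        have "\<forall>x\<in>G. e * eval_word x (l @ [tok]) = (u * e) * x * e"
        proof
          fix x assume x: "x \<in> G"
          have "e * eval_word x (l @ [tok]) = (e * eval_word x l) * x"
            using None by (simp only: eval eval_word_single)
          also have "\<dots> = u * x" using False step x by simp
          also have "\<dots> = (u * e) * x * e" using x by (rule absorb)
          finally show "e * eval_word x (l @ [tok]) = (u * e) * x * e" .
        qed
        moreover have "(\<lambda>x. u * e) \<in> polys G 0" using ueG by auto
        ultimately show ?thesis using None by (intro end_var)
      qed
    next
      case (Some a)
      have "e * (u * a) = u * a" using u by (simp add: mult.assoc[symmetric])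
      have step_a: "e * eval_word x (l @ [tok]) = e * eval_word x l * a" for x
        using Some by (simp only: eval eval_word_single)
      show ?thesis
      proof (cases "None \<in> set l")
        case True
        then obtain n f where f: "f \<in> polys G n" "\<forall>x\<in>G. e * eval_word x l = f x * x * u"
          using step by auto
        have "\<forall>x\<in>G. e * eval_word x (l @ [tok]) = f x * x * (u * a)"
          unfolding step_a using f(2) by (simp add: mult.assoc)
        then have "\<exists>n f. f \<in> polys G n \<and> (\<forall>x\<in>G. e * eval_word x (l @ [tok]) = f x * x * (u * a))"
          using f(1) by blast
        then show ?thesis using \<open>e * (u * a) = u * a\<close> True by (intro exI[of _ "u * a"]) simp
      next
        case False
        then have "\<forall>x\<in>G. e * eval_word x (l @ [tok]) = u * a"
          unfolding step_a using step by simp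
        then show ?thesis
          using \<open>e * (u * a) = u * a\<close> False Some by (intro exI[of _ "u * a"]) simp
      qed
    qed
  qed
qed simp

lemma compress_word_poly:
  assumes "None \<in> set l"
  obtains n f where "1 \<le> n" "f \<in> polys G n" "\<And>x. x \<in> G \<Longrightarrow> e * eval_word x l * e = f x"
proof -
  have "l \<noteq> []" using assms by auto
  then obtain u n f where u: "e * u = u" and f: "f \<in> polys G n"
    and eq: "\<forall>x\<in>G. e * eval_word x l = f x * x * u"
    using compress_word[of l] assms by auto
  have "u * e \<in> G" using u by (simp add: G_def mult.assoc[symmetric]) (simp add: mult.assoc)
  then have "(\<lambda>x. f x * x * (u * e)) \<in> polys G (Suc n)" using f by (rule polys_SucI[rotated])
  moreover have "e * eval_word x l * e = f x * x * (u * e)" if "x \<in> G" for x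
    using eq that by (simp add: mult.assoc)
  ultimately show ?thesis using that[of "Suc n"] by simp
qed

text \<open>Recording the arguments together with the values turns the passage from degree \<open>n\<close> to degree \<open>n + 1\<close>
into a continuous image, so that compactness follows by induction on the degree without a topology
on tuples of coefficients.\<close>

definition poly_graph :: "nat \<Rightarrow> (('a \<times> 'a) \<times> ('a \<times> 'a)) set" where
  "poly_graph n = {((x, y), (f x, f y)) | f x y. f \<in> polys G n \<and> x \<in> G \<and> y \<in> G}"

lemma poly_graphI: "f \<in> polys G n \<Longrightarrow> x \<in> G \<Longrightarrow> y \<in> G \<Longrightarrow> ((x, y), (f x, f y)) \<in> poly_graph n"
  by (auto simp: poly_graph_def)

abbreviation "TT \<equiv> prod_topology T T"

lemma compactin_poly_graph: "compactin (prod_topology TT TT) (poly_graph n)"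
proof (induction n)
  case 0
  have cG: "compactin T G" using closedin_G compactin_iff_closedin by blast
  have "compactin (prod_topology TT T) ((G \<times> G) \<times> G)"
    using cG by (simp add: compactin_Times)
  moreover have "continuous_map (prod_topology TT T) (prod_topology TT TT) (\<lambda>p. (fst p, (snd p, snd p)))"
    by (intro continuous_map_pairedI continuous_map_fst continuous_map_snd)
  ultimately have "compactin (prod_topology TT TT) ((\<lambda>p. (fst p, (snd p, snd p))) ` ((G \<times> G) \<times> G))"
    by (rule image_compactin)
  moreover have "(\<lambda>p. (fst p, (snd p, snd p))) ` ((G \<times> G) \<times> G) = poly_graph 0"
    by (force simp: poly_graph_def)
  ultimately show ?case by simp
next
  case (Suc n)
  let ?Z = "prod_topology (prod_topology TT TT) T"
  let ?F = "\<lambda>p. (fst (fst p), (fst (snd (fst p)) * fst (fst (fst p)) * snd p,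
                              snd (snd (fst p)) * snd (fst (fst p)) * snd p))"
  have cG: "compactin T G" using closedin_G compactin_iff_closedin by blast
  have 1: "compactin ?Z (poly_graph n \<times> G)"
    using cG Suc by (simp add: compactin_Times)
  have c1: "continuous_map ?Z (prod_topology TT TT) fst" by (rule continuous_map_fst)
  have c2: "continuous_map ?Z TT (\<lambda>p. fst (fst p))"
    using continuous_map_compose[OF c1 continuous_map_fst] by (simp add: o_def)
  have c3: "continuous_map ?Z TT (\<lambda>p. snd (fst p))"
    using continuous_map_compose[OF c1 continuous_map_snd] by (simp add: o_def)
  have c4: "continuous_map ?Z T (\<lambda>p. fst (fst (fst p)))" "continuous_map ?Z T (\<lambda>p. snd (fst (fst p)))"
    using continuous_map_compose[OF c2 continuous_map_fst] continuous_map_compose[OF c2 continuous_map_snd]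
    by (simp_all add: o_def)
  have c5: "continuous_map ?Z T (\<lambda>p. fst (snd (fst p)))" "continuous_map ?Z T (\<lambda>p. snd (snd (fst p)))"
    using continuous_map_compose[OF c3 continuous_map_fst] continuous_map_compose[OF c3 continuous_map_snd]
    by (simp_all add: o_def)
  have c6: "continuous_map ?Z T snd" by (rule continuous_map_snd)
  have "continuous_map ?Z (prod_topology TT TT) ?F"
    by (intro continuous_map_pairedI continuous_map_mult c2 c4 c5 c6)
  with 1 have "compactin (prod_topology TT TT) (?F ` (poly_graph n \<times> G))"
    by (rule image_compactin)
  moreover have "?F ` (poly_graph n \<times> G) = poly_graph (Suc n)"
  proof (intro equalityI subsetI)
    fix q assume "q \<in> ?F ` (poly_graph n \<times> G)"
    then obtain f x y a where f: "f \<in> polys G n" "x \<in> G" "y \<in> G" "a \<in> G"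
      and q: "q = ((x, y), (f x * x * a, f y * y * a))"
      unfolding poly_graph_def by auto
    then show "q \<in> poly_graph (Suc n)"
      using poly_graphI[OF polys_SucI[OF f(1,4)] f(2,3)] by simp
  next
    fix q assume "q \<in> poly_graph (Suc n)"
    then obtain f x y a where f: "f \<in> polys G n" "x \<in> G" "y \<in> G" "a \<in> G"
      and q: "q = ((x, y), (f x * x * a, f y * y * a))"
      unfolding poly_graph_def by auto
    then show "q \<in> ?F ` (poly_graph n \<times> G)"
      by (intro image_eqI[of _ _ "(((x, y), (f x, f y)), a)"]) (auto simp: poly_graph_def)
  qed
  ultimately show ?case by simp
qed

end

section \<open>Congruences defined by continuous functions\<close>

context compact_semigroup
begin

text \<open>Quantifying over all translates makes the kernel of the functions \<open>h i\<close> a congruence, as for the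
syntactic congruence of a language. For continuous \<open>h i\<close>, the quotient plays the role of a metrizable
quotient semigroup.\<close>

definition syntactic_rel :: "(nat \<Rightarrow> 'a \<Rightarrow> real) \<Rightarrow> 'a rel" where
  "syntactic_rel h = {(x, y). \<forall>i a b. h i (a * x * b) = h i (a * y * b)}"

lemma equiv_syntactic_rel: "equiv UNIV (syntactic_rel h)"
  by (auto simp: syntactic_rel_def equiv_def refl_on_def sym_def trans_def)

lemma syntactic_rel_mult:
  assumes "(x, y) \<in> syntactic_rel h" "(u, v) \<in> syntactic_rel h"
  shows "(x * u, y * v) \<in> syntactic_rel h"
proof -
  have "h i (a * (x * u) * b) = h i (a * (y * v) * b)" for i a b
  proof -
    have "h i (a * (x * u) * b) = h i (a * x * (u * b))" by (simp add: mult.assoc)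
    also have "\<dots> = h i (a * y * (u * b))" using assms(1) by (simp add: syntactic_rel_def)
    also have "\<dots> = h i ((a * y) * u * b)" by (simp add: mult.assoc)
    also have "\<dots> = h i ((a * y) * v * b)" using assms(2) by (simp add: syntactic_rel_def)
    finally show ?thesis by (simp add: mult.assoc)
  qed
  then show ?thesis by (simp add: syntactic_rel_def)
qed

lemma closedin_syntactic_rel:
  assumes "\<And>i. continuous_map T euclideanreal (h i)"
  shows "closedin (prod_topology T T) (syntactic_rel h)"
proof -
  let ?C = "\<lambda>(i, a, b). {p \<in> topspace (prod_topology T T).
               h i (a * fst p * b) - h i (a * snd p * b) \<in> {0}}"
  have "closedin (prod_topology T T) (?C (i, a, b))" for i a b
  proof -
    have "continuous_map (prod_topology T T) T (\<lambda>p. a * fst p * b)"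
         "continuous_map (prod_topology T T) T (\<lambda>p. a * snd p * b)"
      by (intro continuous_map_mult continuous_map_fst continuous_map_snd; simp)+
    from this[THEN continuous_map_compose, OF assms]
    have "continuous_map (prod_topology T T) euclideanreal (\<lambda>p. h i (a * fst p * b) - h i (a * snd p * b))"
      by (intro continuous_map_diff) (simp_all add: o_def)
    then show ?thesis by (simp only: prod.case) (rule closedin_continuous_map_preimage, auto)
  qed
  then have "closedin (prod_topology T T) (\<Inter>t\<in>UNIV. ?C t)"
    by (intro closedin_INT) auto
  moreover have "(\<Inter>t\<in>UNIV. ?C t) = syntactic_rel h"
    by (auto simp: syntactic_rel_def)
  ultimately show ?thesis by simp
qed

text \<open>Uniform closeness over all \<open>a\<close> and \<open>b\<close> is an open condition: the exceptional points form the
projection of a closed set along the compact space of pairs \<open>(a, b)\<close>.\<close>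

lemma finite_syntactic_net:
  fixes h :: "'a \<Rightarrow> real"
  assumes h: "continuous_map T euclideanreal h" and "\<epsilon> > 0"
  obtains D where "finite D" "\<And>x. \<exists>d\<in>D. \<forall>a b. \<bar>h (a * x * b) - h (a * d * b)\<bar> < \<epsilon>"
proof -
  define U where "U d = {x. \<forall>a b. \<bar>h (a * x * b) - h (a * d * b)\<bar> < \<epsilon>}" for d
  have open_U: "openin T (U d)" for d
  proof -
    let ?Z = "prod_topology T (prod_topology T T)"
    let ?B = "{p \<in> topspace ?Z. \<bar>h (fst (snd p) * fst p * snd (snd p)) - h (fst (snd p) * d * snd (snd p))\<bar> \<in> {\<epsilon>..}}"
    have c: "continuous_map ?Z T (\<lambda>p. fst (snd p))" "continuous_map ?Z T (\<lambda>p. snd (snd p))"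
      using continuous_map_compose[OF continuous_map_snd continuous_map_fst]
        continuous_map_compose[OF continuous_map_snd continuous_map_snd]
      by (simp_all add: o_def)
    have "continuous_map ?Z T (\<lambda>p. fst (snd p) * fst p * snd (snd p))"
      by (intro continuous_map_mult c continuous_map_fst)
    moreover have "continuous_map ?Z T (\<lambda>p. fst (snd p) * d * snd (snd p))"
      by (intro continuous_map_mult c) simp
    ultimately have "continuous_map ?Z euclideanreal
        (\<lambda>p. \<bar>h (fst (snd p) * fst p * snd (snd p)) - h (fst (snd p) * d * snd (snd p))\<bar>)"
      using continuous_map_compose[OF _ h] by (intro continuous_map_real_abs continuous_map_diff) (simp_all add: o_def)
    then have "closedin ?Z ?B" by (rule closedin_continuous_map_preimage) simp
    moreover have "compact_space (prod_topology T T)"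
      by (simp add: compact_space_prod_topology compact_space)
    ultimately have "closedin T (fst ` ?B)"
      using closed_map_fst unfolding closed_map_def by blast
    moreover have "U d = topspace T - fst ` ?B"
    proof (intro equalityI subsetI)
      show "x \<in> topspace T - fst ` ?B" if "x \<in> U d" for x
        using that by (auto simp: U_def not_le[symmetric])
      show "x \<in> U d" if x: "x \<in> topspace T - fst ` ?B" for x
      proof (rule ccontr)
        assume "x \<notin> U d"
        then obtain a b where "\<epsilon> \<le> \<bar>h (a * x * b) - h (a * d * b)\<bar>"
          by (auto simp: U_def not_less)
        then have "(x, (a, b)) \<in> ?B" by simp
        then have "fst (x, (a, b)) \<in> fst ` ?B" by (rule imageI)
        then show False using x by simp
      qed
    qed
    ultimately show ?thesis by (simp only:) (rule openin_diff[OF openin_topspace])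
  qed
  have "x \<in> U x" for x using \<open>\<epsilon> > 0\<close> by (simp add: U_def)
  then have "topspace T \<subseteq> \<Union>(range U)" by auto
  then obtain \<F> where "finite \<F>" "\<F> \<subseteq> range U" "topspace T \<subseteq> \<Union>\<F>"
    using compactinD[of T "topspace T" "range U"] compact_space open_U
    unfolding compact_space_def by blast
  moreover obtain D where "finite D" "\<F> = U ` D"
    using finite_subset_image[OF \<open>finite \<F>\<close> \<open>\<F> \<subseteq> range U\<close>] by blast
  ultimately have "\<exists>d\<in>D. x \<in> U d" for x by auto
  then show ?thesis using that[OF \<open>finite D\<close>] by (simp add: U_def)
qed

text \<open>For each function and each precision, choose a finite net. Whether a point is near a given member
of a given net is one of countably many yes-no questions, and the answers determine the point up to
the congruence. Hence there are at most continuum many classes.\<close>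

lemma syntactic_code:
  assumes "\<And>i. continuous_map T euclideanreal (h i)"
  shows "\<exists>code :: 'a \<Rightarrow> nat set. \<forall>x y. code x = code y \<longrightarrow> (x, y) \<in> syntactic_rel h"
proof -
  define close where "close i n d x \<longleftrightarrow> (\<forall>a b. \<bar>h i (a * x * b) - h i (a * d * b)\<bar> < 1 / real (Suc n))"
    for i n d x
  have "\<exists>D. finite D \<and> (\<forall>x. \<exists>d\<in>D. close i n d x)" for i n
    using finite_syntactic_net[OF assms[of i], of "1 / real (Suc n)"] unfolding close_def
    by (metis of_nat_0_less_iff zero_less_Suc zero_less_divide_1_iff)
  then obtain D where D: "\<And>i n. finite (D i n)" "\<And>i n x. \<exists>d\<in>D i n. close i n d x"
    by metis
  define net where "net i n = from_nat_into (D i n)" for i n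
  have net: "\<exists>j. close i n (net i n j) x" for i n x
  proof -
    obtain d where "d \<in> D i n" "close i n d x" using D(2) by blast
    then show ?thesis
      unfolding net_def using D(1) by (metis countable_finite from_nat_into_surj)
  qed
  define code where "code x = {prod_encode (i, prod_encode (n, j)) | i n j. close i n (net i n j) x}" for x
  have code_iff: "prod_encode (i, prod_encode (n, j)) \<in> code x \<longleftrightarrow> close i n (net i n j) x" for x i n j
    by (auto simp: code_def)
  show ?thesis
  proof (intro exI[of _ code] allI impI)
    fix x y assume eq: "code x = code y"
    have "h i (a * x * b) = h i (a * y * b)" for i a b
    proof (rule ccontr)
      assume "h i (a * x * b) \<noteq> h i (a * y * b)"
      then have "0 < \<bar>h i (a * x * b) - h i (a * y * b)\<bar> / 2" by simp
      then obtain n where n: "inverse (real (Suc n)) < \<bar>h i (a * x * b) - h i (a * y * b)\<bar> / 2"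
        using reals_Archimedean by blast
      obtain j where j: "close i n (net i n j) x" using net by blast
      then have "close i n (net i n j) y" using eq code_iff by metis
      with j have "\<bar>h i (a * x * b) - h i (a * net i n j * b)\<bar> < 1 / real (Suc n)"
        "\<bar>h i (a * y * b) - h i (a * net i n j * b)\<bar> < 1 / real (Suc n)"
        unfolding close_def by blast+
      moreover have False if "\<bar>r - t\<bar> < \<delta>" "\<bar>s - t\<bar> < \<delta>" "\<delta> < \<bar>r - s\<bar> / 2" for r s t \<delta> :: real
        using that abs_triangle_ineq4[of "r - t" "s - t"] by simp
      ultimately show False using n unfolding inverse_eq_divide by blast
    qed
    then show "(x, y) \<in> syntactic_rel h" by (simp add: syntactic_rel_def)
  qed
qed

end

section \<open>Pairs that polynomials of bounded degree do not identify\<close>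

context compact_semigroup_with_group
begin

text \<open>Failure of polyfiniteness for the single set \<open>F = {e}\<close> suffices: if a polynomial over the group took
equal values at two points, then left multiplication by the inverse of that value would map both
points to \<open>e\<close>.\<close>

lemma polys_separate_pairs:
  assumes "\<not> polyfinite TYPE('a)"
  obtains p q :: "nat \<Rightarrow> 'a"
  where "\<And>n. p n \<in> G" "\<And>n. q n \<in> G"
    and "\<And>n m f. 1 \<le> m \<Longrightarrow> m \<le> n \<Longrightarrow> f \<in> polys G m \<Longrightarrow> f (p n) \<noteq> f (q n)"
proof -
  have "\<exists>z. fst z \<in> G \<and> snd z \<in> G \<and> (\<forall>m f. 1 \<le> m \<longrightarrow> m \<le> n \<longrightarrow> f \<in> polys G m \<longrightarrow> f (fst z) \<noteq> f (snd z))" for n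
  proof -
    define merges where "merges x y \<longleftrightarrow> (\<exists>m f. m \<le> n \<and> semigroup_polynomial m f \<and> {f x, f y} \<subseteq> {e})"
      for x y :: 'a
    have "\<not> (\<forall>x y. merges x y)"
    proof
      assume "\<forall>x y. merges x y"
      then have "polyfinite TYPE('a)"
        unfolding polyfinite_def merges_def by (intro exI[of _ n] exI[of _ "{e}"]) simp
      then show False using assms by blast
    qed
    then obtain x y where xy: "\<not> merges x y" by blast
    have "f (e * x * e) \<noteq> f (e * y * e)" if f: "1 \<le> m" "m \<le> n" "f \<in> polys G m" for m f
    proof
      assume eq: "f (e * x * e) = f (e * y * e)"
      obtain u where u: "u \<in> G" "u * f (e * x * e) = e"
        using G_inverse polys_in_G[OF f(3)] compress_in_G by blast
      have "(\<lambda>x. u * f x) \<in> polys G m" using f(3) u(1) by (rule polys_left_mult)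
      then have "semigroup_polynomial m (\<lambda>x. u * f x)" using f(1) by (rule polys_semigroup_polynomial)
      moreover have "u * f x = e" "u * f y = e"
        using u(2) eq polys_compress[OF f(3)] by simp_all
      ultimately have "m \<le> n \<and> semigroup_polynomial m (\<lambda>x. u * f x) \<and> {u * f x, u * f y} \<subseteq> {e}"
        using f(2) by simp
      then have "merges x y" unfolding merges_def by (intro exI)
      then show False using xy by blast
    qed
    then show ?thesis using compress_in_G by (intro exI[of _ "(e * x * e, e * y * e)"]) simp
  qed
  then obtain z where "\<And>n. fst (z n) \<in> G \<and> snd (z n) \<in> G \<and>
      (\<forall>m f. 1 \<le> m \<longrightarrow> m \<le> n \<longrightarrow> f \<in> polys G m \<longrightarrow> f (fst (z n)) \<noteq> f (snd (z n)))"
    by metis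
  then show ?thesis using that[of "\<lambda>n. fst (z n)" "\<lambda>n. snd (z n)"] by blast
qed

text \<open>The values at \<open>p n\<close> of the polynomials of degree at most \<open>n\<close> that send \<open>q n\<close> to \<open>e\<close> form a compact
set \<open>C n\<close> without \<open>e\<close>. A continuous function that separates \<open>C n\<close> from \<open>e\<close>, one for each \<open>n\<close>, keeps
the pair separated modulo the congruence defined by these functions.\<close>

lemma polys_separate_pairs_modulo:
  assumes pq: "\<And>n. p n \<in> G" "\<And>n. q n \<in> G"
    and sep: "\<And>n m f. 1 \<le> m \<Longrightarrow> m \<le> n \<Longrightarrow> f \<in> polys G m \<Longrightarrow> f (p n) \<noteq> f (q n)"
  obtains h where "\<And>i. continuous_map T euclideanreal (h i)"
    and "\<And>n m f. 1 \<le> m \<Longrightarrow> m \<le> n \<Longrightarrow> f \<in> polys G m \<Longrightarrow> (f (p n), f (q n)) \<notin> syntactic_rel h"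
proof -
  define C where "C n = (\<Union>m\<in>{1..n}. {u \<in> topspace T. ((p n, q n), (u, e)) \<in> poly_graph m})" for n
  have closed_C: "closedin T (C n)" for n
    unfolding C_def
  proof (rule closedin_Union, simp)
    fix A assume "A \<in> (\<lambda>m. {u \<in> topspace T. ((p n, q n), (u, e)) \<in> poly_graph m}) ` {1..n}"
    then obtain m where A: "A = {u \<in> topspace T. ((p n, q n), (u, e)) \<in> poly_graph m}" by blast
    have "Hausdorff_space (prod_topology TT TT)"
      using Hausdorff_space by (simp add: Hausdorff_space_prod_topology)
    then have "closedin (prod_topology TT TT) (poly_graph m)"
      using compactin_poly_graph by (rule compactin_imp_closedin)
    moreover have "continuous_map T (prod_topology TT TT) (\<lambda>u. ((p n, q n), (u, e)))"
      by (intro continuous_map_pairedI continuous_map_id[unfolded id_def]) simp_all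
    ultimately show "closedin T A"
      unfolding A by (rule closedin_continuous_map_preimage[rotated])
  qed
  have "e \<notin> C n" for n
    using sep unfolding C_def poly_graph_def by auto (metis Suc_leI zero_less_iff_neq_zero le_zero_eq not_less_eq_eq One_nat_def)
  then have "\<exists>g. continuous_map T euclideanreal g \<and> g e = 0 \<and> (\<forall>u\<in>C n. g u = 1)" for n
  proof -
    have "normal_space T"
      using compact_space Hausdorff_space by (simp add: compact_Hausdorff_or_regular_imp_normal_space)
    then obtain g where "continuous_map T euclideanreal g" "g ` {e} \<subseteq> {0 :: real}" "g ` C n \<subseteq> {1}"
      using Urysohn_lemma_alt[of T "{e}" "C n" 0 1] closedin_point closed_C \<open>e \<notin> C n\<close>
      by (auto simp: disjnt_def)
    then show ?thesis by (intro exI[of _ g]) auto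
  qed
  then obtain h where h: "\<And>n. continuous_map T euclideanreal (h n)" "\<And>n. h n e = 0"
      "\<And>n u. u \<in> C n \<Longrightarrow> h n u = (1 :: real)"
    by metis
  have "(f (p n), f (q n)) \<notin> syntactic_rel h" if f: "1 \<le> m" "m \<le> n" "f \<in> polys G m" for n m f
  proof
    assume rel: "(f (p n), f (q n)) \<in> syntactic_rel h"
    obtain u where u: "u \<in> G" "u * f (q n) = e"
      using G_inverse polys_in_G[OF f(3) pq(2)] by blast
    have uf: "(\<lambda>x. u * f x) \<in> polys G m" using f(3) u(1) by (rule polys_left_mult)
    have "((p n, q n), (u * f (p n), u * f (q n))) \<in> poly_graph m"
      using poly_graphI[OF uf pq(1) pq(2)] .
    then have "u * f (p n) \<in> C n" using f(1,2) u(2) by (auto simp: C_def)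
    then have "h n (u * f (p n)) = 1" by (rule h(3))
    moreover have "e * (u * f (p n)) * e = u * f (p n)"
      using polys_in_G[OF uf pq(1)] by (simp add: G_def)
    moreover have "(u * f (p n), u * f (q n)) \<in> syntactic_rel h"
      using rel by (intro syntactic_rel_mult) (simp_all add: syntactic_rel_def)
    then have "h n (e * (u * f (p n)) * e) = h n (e * (u * f (q n)) * e)"
      unfolding syntactic_rel_def by blast
    ultimately show False using h(2) u(2) by simp
  qed
  then show ?thesis using that h(1) by blast
qed

text \<open>Constants glue every pair, whence the lower bound \<open>1\<close> on the degree; the upper bound keeps the
relation closed.\<close>

definition poly_glued :: "'a rel \<Rightarrow> nat \<Rightarrow> 'a rel" where
  "poly_glued E n = {(x, y). x \<in> G \<and> y \<in> G \<and> (\<exists>m f. 1 \<le> m \<and> m \<le> n \<and> f \<in> polys G m \<and> (f x, f y) \<in> E)}"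

lemma poly_gluedI:
  "x \<in> G \<Longrightarrow> y \<in> G \<Longrightarrow> 1 \<le> m \<Longrightarrow> m \<le> n \<Longrightarrow> f \<in> polys G m \<Longrightarrow> (f x, f y) \<in> E \<Longrightarrow>
    (x, y) \<in> poly_glued E n"
  unfolding poly_glued_def by (simp, blast)

lemma closedin_poly_glued:
  assumes "closedin TT E"
  shows "closedin (prod_topology (subtopology T G) (subtopology T G)) (poly_glued E n)"
proof -
  have "poly_glued E n = (\<Union>m\<in>{1..n}. fst ` (poly_graph m \<inter> {p \<in> topspace (prod_topology TT TT). snd p \<in> E}))"
  proof (intro equalityI subsetI)
    fix z assume "z \<in> poly_glued E n"
    then obtain x y m f where z: "z = (x, y)" and xy: "x \<in> G" "y \<in> G"
      and f: "m \<in> {1..n}" "f \<in> polys G m" "(f x, f y) \<in> E"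
      unfolding poly_glued_def by auto
    have "((x, y), (f x, f y)) \<in> poly_graph m \<inter> {p \<in> topspace (prod_topology TT TT). snd p \<in> E}"
      using poly_graphI[OF f(2) xy] f(3) by simp
    then show "z \<in> (\<Union>m\<in>{1..n}. fst ` (poly_graph m \<inter> {p \<in> topspace (prod_topology TT TT). snd p \<in> E}))"
      using f(1) z by (intro UN_I[of m] image_eqI[of _ _ "((x, y), (f x, f y))"]) simp_all
  next
    fix z assume "z \<in> (\<Union>m\<in>{1..n}. fst ` (poly_graph m \<inter> {p \<in> topspace (prod_topology TT TT). snd p \<in> E}))"
    then obtain x y m f where "z = (x, y)" "x \<in> G" "y \<in> G" "m \<in> {1..n}" "f \<in> polys G m" "(f x, f y) \<in> E"
      unfolding poly_graph_def by auto
    then show "z \<in> poly_glued E n" using poly_gluedI[of x y m n f E] by simp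
  qed
  moreover have "closedin TT (fst ` (poly_graph m \<inter> {p \<in> topspace (prod_topology TT TT). snd p \<in> E}))" for m
  proof -
    have "closedin (prod_topology TT TT) {p \<in> topspace (prod_topology TT TT). snd p \<in> E}"
      using continuous_map_snd assms by (rule closedin_continuous_map_preimage)
    then have "compactin (prod_topology TT TT) (poly_graph m \<inter> {p \<in> topspace (prod_topology TT TT). snd p \<in> E})"
      using compactin_poly_graph by (intro compact_Int_closedin)
    then have "compactin TT (fst ` (poly_graph m \<inter> {p \<in> topspace (prod_topology TT TT). snd p \<in> E}))"
      using continuous_map_fst by (rule image_compactin)
    moreover have "Hausdorff_space TT"
      using Hausdorff_space by (simp add: Hausdorff_space_prod_topology)
    ultimately show ?thesis by (intro compactin_imp_closedin)
  qed
  ultimately have "closedin TT (poly_glued E n)"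
    by (simp only:) (rule closedin_Union, auto)
  moreover have "poly_glued E n \<subseteq> G \<times> G" by (auto simp: poly_glued_def)
  ultimately show ?thesis
    unfolding subtopology_Times[symmetric] by (rule closedin_subset_topspace)
qed

text \<open>Suppose that all pairs from a nonempty open \<open>W\<close> are glued in degree \<open>n\<close>, and let \<open>w\<close> be in \<open>W\<close>. By
recurrence and compactness, for every group element \<open>x\<close> some \<open>w x\<^sup>k\<close> lies in \<open>W\<close>, with a bound
\<open>K + 1\<close> on the exponent. For large \<open>N\<close>, the polynomial \<open>r x = w (x (q N)\<^sup>-\<^sup>1)\<^sup>k\<close> maps \<open>p N\<close> into \<open>W\<close>
and \<open>q N\<close> to \<open>w\<close>; composing it with a polynomial that glues these two values glues \<open>p N\<close> and \<open>q N\<close>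
in degree at most \<open>N\<close>, which is impossible.\<close>

lemma poly_glued_thin:
  assumes pq: "\<And>n. p n \<in> G" "\<And>n. q n \<in> G"
    and sep: "\<And>n m f. 1 \<le> m \<Longrightarrow> m \<le> n \<Longrightarrow> f \<in> polys G m \<Longrightarrow> (f (p n), f (q n)) \<notin> E"
    and W: "openin (subtopology T G) W" "W \<noteq> {}"
  shows "\<exists>x\<in>W. \<exists>y\<in>W. (x, y) \<notin> poly_glued E n"
proof (rule ccontr)
  assume "\<not> ?thesis"
  then have glued: "(x, y) \<in> poly_glued E n" if "x \<in> W" "y \<in> W" for x y using that by blast
  obtain V where V: "openin T V" "W = V \<inter> G" using W(1) by (auto simp: openin_subtopology)
  obtain w where w: "w \<in> W" using W(2) by blast
  then have wG: "w \<in> G" using V by blast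
  let ?pow = "\<lambda>x k. ((\<lambda>u. u * x) ^^ k) e"
  define R where "R k = {x \<in> topspace T. w * ?pow x (Suc k) \<in> V}" for k
  have cont_pow: "continuous_map T T (\<lambda>x. ?pow x k)" for k
  proof (induction k)
    case (Suc k)
    then show ?case by (simp, intro continuous_map_mult continuous_map_id[unfolded id_def])
  qed simp
  have open_R: "openin T (R k)" for k
  proof -
    have "continuous_map T T (\<lambda>x. w * ?pow x (Suc k))"
      by (intro continuous_map_mult cont_pow) simp
    then show ?thesis unfolding R_def using V(1) by (rule openin_continuous_map_preimage)
  qed
  have "G \<subseteq> \<Union>(range R)"
  proof
    fix x assume x: "x \<in> G"
    have "continuous_map T T (\<lambda>u. w * u)"
      by (intro continuous_map_mult continuous_map_id[unfolded id_def]) simp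
    then have "openin T {u \<in> topspace T. w * u \<in> V}"
      using V(1) by (rule openin_continuous_map_preimage)
    moreover have "e \<in> {u \<in> topspace T. w * u \<in> V}" using w V wG by (auto simp: G_def)
    ultimately obtain k where "?pow x (Suc k) \<in> {u \<in> topspace T. w * u \<in> V}"
      using x by (rule recurrence)
    then show "x \<in> \<Union>(range R)" by (auto simp: R_def)
  qed
  moreover have "compactin T G" using closedin_G compactin_iff_closedin by blast
  ultimately obtain \<F> where \<F>: "finite \<F>" "\<F> \<subseteq> range R" "G \<subseteq> \<Union>\<F>"
    using compactinD[of T G "range R"] open_R by blast
  then obtain I where I: "finite I" "\<F> = R ` I" using finite_subset_image by metis
  obtain K where K: "\<And>k. k \<in> I \<Longrightarrow> k \<le> K" using I(1) finite_nat_set_iff_bounded_le by auto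
  \<comment> \<open>The composite below has degree at most n times the largest exponent.\<close>
  define N where "N = n * Suc K"
  obtain v where v: "v \<in> G" "q N * v = e" using G_inverse[OF pq(2)] by blast
  have "p N * v \<in> G" using pq(1) v(1) by (rule G_mult)
  then obtain k where k: "k \<in> I" "p N * v \<in> R k" using \<F>(3) I(2) by blast
  let ?r = "\<lambda>x. w * ?pow (x * v) (Suc k)"
  have r: "?r \<in> polys G (Suc k)" using wG v(1) by (rule polys_power)
  have "?r (p N) \<in> W" using k(2) polys_in_G[OF r pq(1)] unfolding R_def V(2) by blast
  moreover have "?pow e j = e" for j by (induction j) simp_all
  then have "?r (q N) = w" using v(2) wG by (simp only: G_def) simp
  ultimately have "(?r (p N), ?r (q N)) \<in> poly_glued E n" using glued w by metis
  then obtain m f where f: "1 \<le> m" "m \<le> n" "f \<in> polys G m" "(f (?r (p N)), f (?r (q N))) \<in> E"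
    unfolding poly_glued_def by blast
  have "(\<lambda>x. f (?r x)) \<in> polys G (m * Suc k)"
    using f(3) r by (rule polys_compose[rotated]) (use G_mult in blast)
  moreover have "m * Suc k \<le> N" unfolding N_def using f(2) K[OF k(1)] by (intro mult_le_mono) simp_all
  moreover have "1 \<le> m * Suc k" using f(1) by simp
  ultimately show False using sep f(4) by blast
qed

text \<open>Two solutions of one equation are glued by its left-hand side, which after compression is a
polynomial over the group of some degree \<open>n\<close>. Hence a solution is determined by the first \<open>n\<close> digits
of its index.\<close>

lemma finite_solutions:
  assumes E: "equiv UNIV E"
    and cong: "\<And>x y u v. (x, y) \<in> E \<Longrightarrow> (u, v) \<in> E \<Longrightarrow> (x * u, y * v) \<in> E"
    and \<zeta>: "\<And>t. \<zeta> t \<in> G"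
    and inj: "\<And>s t n. (\<zeta> s, \<zeta> t) \<in> poly_glued E n \<Longrightarrow> s \<inter> {..<n} = t \<inter> {..<n} \<Longrightarrow> s = t"
    and "None \<in> set l"
  shows "finite {t :: nat set. (eval_word (\<zeta> t) l, g) \<in> E}"
proof -
  obtain n f where f: "1 \<le> n" "f \<in> polys G n" "\<And>x. x \<in> G \<Longrightarrow> e * eval_word x l * e = f x"
    using compress_word_poly[OF \<open>None \<in> set l\<close>] by blast
  have E_refl: "(x, x) \<in> E" for x using E by (meson UNIV_I equivE refl_onD)
  have sol: "(f (\<zeta> t), e * g * e) \<in> E" if "(eval_word (\<zeta> t) l, g) \<in> E" for t
    using cong[OF cong[OF E_refl that] E_refl, of e e] f(3)[OF \<zeta>] by simp
  have "inj_on (\<lambda>t. t \<inter> {..<n}) {t. (eval_word (\<zeta> t) l, g) \<in> E}"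
  proof (rule inj_onI)
    fix s t assume "s \<in> {t. (eval_word (\<zeta> t) l, g) \<in> E}" "t \<in> {t. (eval_word (\<zeta> t) l, g) \<in> E}"
    then have "(f (\<zeta> s), e * g * e) \<in> E" "(e * g * e, f (\<zeta> t)) \<in> E"
      using sol E by (simp_all add: equiv_def symD)
    then have "(f (\<zeta> s), f (\<zeta> t)) \<in> E"
      using E by (auto simp: equiv_def dest: transD)
    then have "(\<zeta> s, \<zeta> t) \<in> poly_glued E n"
      using f(1,2) \<zeta> by (intro poly_gluedI[of _ _ n n f]) simp_all
    moreover assume "s \<inter> {..<n} = t \<inter> {..<n}"
    ultimately show "s = t" by (rule inj)
  qed
  moreover have "(\<lambda>t. t \<inter> {..<n}) ` {t. (eval_word (\<zeta> t) l, g) \<in> E} \<subseteq> Pow {..<n}" by auto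
  ultimately show ?thesis by (meson finite_Pow_iff finite_lessThan inj_on_finite)
qed

text \<open>The Cantor scheme for the relations of being glued modulo \<open>E\<close> provides the continuum many candidates
for the transfinite choice.\<close>

lemma not_zero_closed_if_not_polyfinite:
  assumes "\<not> polyfinite TYPE('a)"
  shows "\<not> zero_closed TYPE('a)"
proof -
  obtain p q where pq: "\<And>n. p n \<in> G" "\<And>n. q n \<in> G"
    and sep: "\<And>n m f. 1 \<le> m \<Longrightarrow> m \<le> n \<Longrightarrow> f \<in> polys G m \<Longrightarrow> f (p n) \<noteq> f (q n)"
    using polys_separate_pairs[OF assms] by blast
  obtain h where h: "\<And>i. continuous_map T euclideanreal (h i)"
    and sep_h: "\<And>n m f. 1 \<le> m \<Longrightarrow> m \<le> n \<Longrightarrow> f \<in> polys G m \<Longrightarrow> (f (p n), f (q n)) \<notin> syntactic_rel h"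
  proof (rule polys_separate_pairs_modulo[of p q])
    show "f (p n) \<noteq> f (q n)" if "1 \<le> m" "m \<le> n" "f \<in> polys G m" for n m f
      using that by (rule sep)
  qed (use pq in blast)+
  define E where "E = syntactic_rel h"
  have E: "equiv UNIV E" unfolding E_def by (rule equiv_syntactic_rel)
  obtain code :: "'a \<Rightarrow> nat set" where code_E: "\<forall>x y. code x = code y \<longrightarrow> (x, y) \<in> E"
    unfolding E_def using syntactic_code[of h, OF h] by (rule exE)
  then have code: "\<And>x y. code x = code y \<Longrightarrow> (x, y) \<in> E" by blast
  obtain \<zeta> :: "nat set \<Rightarrow> 'a" where \<zeta>: "\<And>t. \<zeta> t \<in> topspace (subtopology T G)"
    and inj: "\<And>s t n. (\<zeta> s, \<zeta> t) \<in> poly_glued E n \<Longrightarrow> s \<inter> {..<n} = t \<inter> {..<n} \<Longrightarrow> s = t"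
  proof (rule cantor_scheme[of "subtopology T G" "poly_glued E"])
    show "compact_space (subtopology T G)"
      using closedin_G compactin_iff_closedin compact_space_subtopology by blast
    show "Hausdorff_space (subtopology T G)" using Hausdorff_space by (rule Hausdorff_space_subtopology)
    show "topspace (subtopology T G) \<noteq> {}" using compress_in_G by auto
    show "closedin (prod_topology (subtopology T G) (subtopology T G)) (poly_glued E n)" for n
      unfolding E_def by (intro closedin_poly_glued closedin_syntactic_rel h)
    show "poly_glued E m \<subseteq> poly_glued E n" if "m \<le> n" for m n
      using that unfolding poly_glued_def by (auto intro: order_trans)
    show "(y, x) \<in> poly_glued E n" if "(x, y) \<in> poly_glued E n" for n x y
      using that E unfolding poly_glued_def by (auto simp: equiv_def dest: symD)
    show "\<exists>x\<in>W. \<exists>y\<in>W. (x, y) \<notin> poly_glued E n" if "openin (subtopology T G) W" "W \<noteq> {}" for n W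
      using that by (intro poly_glued_thin[of p q, OF pq]) (simp_all add: E_def sep_h)
  qed blast
  show ?thesis
  proof (rule not_zero_closed_if_few_solutions[of E code \<zeta>, OF E _ code])
    show cong: "(x * u, y * v) \<in> E" if "(x, y) \<in> E" "(u, v) \<in> E" for x y u v
      using that unfolding E_def by (rule syntactic_rel_mult)
    show "finite {t. (eval_word (\<zeta> t) l, g) \<in> E}" if "None \<in> set l" for l g
      using E cong _ inj that by (rule finite_solutions) (use \<zeta> in auto)
  qed
qed

end

section \<open>Zero-closed compact semigroups\<close>

theorem theorem4:
  fixes T :: "'a::semigroup_mult topology"
  assumes "cov_closed_null =o |UNIV :: real set|"
    and "semigroup_topology T" and "compact_space T" and "Hausdorff_space T"
    and "zero_closed TYPE('a)"
  shows "polyfinite TYPE('a)"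
proof -
  interpret compact_semigroup T using assms by unfold_locales
  obtain e :: 'a where e: "e * e = e"
    "\<And>x. e * x = x \<Longrightarrow> x * e = x \<Longrightarrow> \<exists>y. e * y = y \<and> y * e = y \<and> y * x = e \<and> x * y = e"
    using ex_unit_of_maximal_group by blast
  interpret compact_semigroup_with_group T e using e by unfold_locales
  show ?thesis using not_zero_closed_if_not_polyfinite assms(5) by blast
qed

end
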